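(* Let $f\colon G\to G$ be a tight homotopy equivalence of a finite graph representing (together with an edge loop $\sigma$ around the puncture) a homeomorphism $\phi$ of a once-punctured surface of genus $g$, and assume that $G$ has no vertices of valence less than three. Then the number of tetrahedra in the triangulation of the mapping torus $M_\phi$ produced from $f$ and $\sigma$ by the construction described in the context is bounded by $16(5g-2)S(f)$, where $S(f)$ denotes the size of $f$.
   Context: **Size and tightness.** For a map $h\colon G'\to G$ of finite graphs sending vertices to vertices and edges to edge paths, the size $S(h)$ is the sum of the lengths (in the usual path metric, each edge of $G$ having length $1$) of the images of the edges of $G'$. A map $h\colon G'\to G$ is tight if (1) for every edge of $G'$, the restriction of $h$ to the interior of the edge is an immersion, and (2) for every vertex $v$ of $G'$ there are two edges emanating from $v$ that cannot be folded (not even after a subdivision), i.e. whose images have no nontrivial common initial path. **Setting.** $S$ is an orientable surface of genus $g$ with one puncture and $\phi\colon S\to S$ is a homeomorphism given as a product of Dehn twists. $M_\phi$ is its mapping torus. $G\subset S$ is a finite graph embedded in $S$ such that the inclusion is a homotopy equivalence. $f\colon G\to G$ is a homotopy equivalence inducing the same outer automorphism of $\pi_1(S)\cong\pi_1(G)$ as $\phi$. $\sigma$ is an (immersed) edge loop in $G$ homotopic in $S$ to a loop around the puncture. Each edge of $G$ occurs exactly twice in $\sigma$, once in each direction. If $\sigma$ is spelled along a circle $S^1$, then identifying the intervals with corresponding labels gives $G$. Taking the cone over $S^1$, removing the cone point and making the same identifications gives $S$. $f$ maps vertices to vertices and edges to edge paths. A bar denotes reversal of an edge or path. **The triangulation.**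 The construction produces a triangulated torus $K$ with a face pairing $e$ (orientation reversing simplicial homeomorphisms between pairs of triangles). The triangulation of $M_\phi$ consists of the cones over the triangles of $K$, glued along the triangles of $K$ according to $e$, with the cone point removed (ideal vertex). So the number of tetrahedra is the number of triangles of $K$. The construction is as follows. *Subdividing and folding.* Put $G_0=G$, $g_0=f$, $\sigma_0=\sigma$. Suppose $g_i\colon G_{2i}\to G$ and $\sigma_{2i}$ have been constructed. If $g_i$ is not an immersion, find two distinct oriented edges $a,b$ emanating from the same vertex of $G_{2i}$ that are adjacent in the spelling of $\sigma_{2i}$ and such that $g_i(a),g_i(b)$ have a nontrivial common initial path. Subdivide $a=a_1a_2$ and $b=b_1b_2$ so that $a_1,b_1$ correspond to the maximal common initial path (an edge lying entirely in this common part is not subdivided). This gives $s_i\colon G_{2i}\to G_{2i+1}$. Identify $a_1$ and $b_1$ to obtain $p_i\colon G_{2i+1}\to G_{2i+2}$, and let $g_{i+1}\colon G_{2i+2}\to G$ be the induced map, so that $g_i=g_{i+1}\circ p_i\circ s_i$. Let $\sigma_{2i+1}=s_i(\sigma_{2i})$, and let $\sigma_{2i+2}$ be obtained from $p_i(\sigma_{2i+1})$ by tightening. Stop when $g_n$ is an immersion; it is then a homeomorphism $G_{2n}\to G$. *Annuli.* For each $i=0,\dots,2n-1$ take an annulus $A_i$ with $\sigma_i$ spelled along one boundary component and $\sigma_{i+1}$ along the other (oriented so as to be freely homotopic). Glue $A_i$ to $A_{i+1}$ along $\sigma_{i+1}$, and glue $A_{2n-1}$ to $A_0$ using $g_n$.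 The result is $K$. On each boundary component the two occurrences of each edge label are paired. *Subdivision annulus $A_{2i}$.* Decompose it into rectangles, one for each occurrence in $\sigma_{2i}$ of an edge that is not subdivided, and polygons (pentagons), one for each occurrence of an edge that is subdivided. The edge pairing induces a pairing of these polygons. Triangulate them without additional vertices, compatibly with the pairing. *Fold annulus $A_{2i+1}$.* Let $a,b$ be the folded edges, $p_i(a)=p_i(b)=b'$. Occurrences of other edges give paired rectangles, each divided into two triangles compatibly with the pairing. After exchanging $a$ and $b$ or reversing both their orientations, $\sigma_{2i+1}$ has a cyclic subpath $w=a\bar b u\bar a$ or $w=a\bar b u b$, where $u$ contains neither $a$ nor $b$. Let $P_0,P_1,P_2$ be the initial point of $a$, the point between $a$ and $\bar b$, and the terminal point of $\bar b$ in $w$. Let $P_m,P_{m+1}$ be the initial and terminal points of the last edge of $w$. If $w=a\bar b u\bar a$, then $\sigma_{2i+2}$ has the subpath $w'=u'\bar b'$, with initial point $Q_0$, terminal point $Q_k$ of $u'$, and terminal point $Q_{k+1}$. Pair $(P_0,P_1,Q_0)$ with $(P_{m+1},P_m,Q_{k+1})$. Divide the rectangle between the other occurrence of $b$ in $\sigma_{2i+1}$ (from $R_0$ to $R_1$) and the corresponding $b'$ in $\sigma_{2i+2}$ (from $S_0$ to $S_1$) by the diagonal $R_1S_0$. Pair $(P_1,P_2,Q_0)$ with $(R_1,R_0,S_0)$ and $(P_m,Q_k,Q_{k+1})$ with $(R_1,S_1,S_0)$. If $w=a\bar b u b$, then $\sigma_{2i+2}$ has the subpath $w'=u'b'$, with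 $Q_0,Q_k,Q_{k+1}$ defined in the same way. Pair $(P_1,P_2,Q_0)$ with $(P_{m+1},P_m,Q_k)$. Divide the rectangle between the other occurrence $\bar a$ in $\sigma_{2i+1}$ (from $R_0$ to $R_1$) and the corresponding $\bar b'$ in $\sigma_{2i+2}$ (from $S_0$ to $S_1$) by the diagonal $R_0S_1$. Pair $(P_0,P_1,Q_0)$ with $(R_1,R_0,S_1)$ and $(P_{m+1},Q_k,Q_{k+1})$ with $(R_0,S_1,S_0)$. Vertices correspond in the listed order. *)

theory Defs
  imports
    "HOL-Analysis.Analysis"
    "HOL-Library.Sublist"
    "Graph_Theory.Bidirected_Digraph"
    "Graph_Theory.Arc_Walk"
begin

section \<open>Finite graphs and maps sending edges to edge paths\<close>

text \<open>
  A finite graph (loops and multiple edges allowed) is a finite bidirected digraph whose arcs are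
  the oriented edges. An oriented edge \<open>(e, b)\<close> is an edge name with a direction, so the
  number of edges is the number of names, and \<^const>\<open>out_degree\<close> is the valence.
\<close>

type_synonym 'e dart = "'e \<times> bool"

definition bar :: "'e dart \<Rightarrow> 'e dart" where
  "bar a = (fst a, \<not> snd a)"

definition bar_path :: "'e dart list \<Rightarrow> 'e dart list" where
  "bar_path p = rev (map bar p)"

type_synonym ('v, 'e) graph = "('v, 'e dart) pre_digraph"

definition finite_graph :: "('v, 'e) graph \<Rightarrow> bool" where
  "finite_graph G \<longleftrightarrow>
     fin_digraph G \<and> bidirected_digraph G (\<lambda>a. if a \<in> arcs G then bar a else a)"

definition edges :: "('v, 'e) graph \<Rightarrow> 'e set" where
  "edges G = fst ` arcs G"

record ('v, 'e) gmap =
  on_vertex :: "'v \<Rightarrow> 'v"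
  on_edge :: "'e dart \<Rightarrow> 'e dart list"

definition graph_map :: "('v, 'e) graph \<Rightarrow> ('v, 'e) graph \<Rightarrow> ('v, 'e) gmap \<Rightarrow> bool" where
  "graph_map G' G h \<longleftrightarrow>
     on_vertex h ` verts G' \<subseteq> verts G \<and>
     (\<forall>a\<in>arcs G'. pre_digraph.awalk G (on_vertex h (tail G' a)) (on_edge h a) (on_vertex h (head G' a))
        \<and> on_edge h (bar a) = bar_path (on_edge h a))"

definition map_size :: "('v, 'e) graph \<Rightarrow> ('v, 'e) gmap \<Rightarrow> nat" where
  "map_size G' h = (\<Sum>e\<in>edges G'. length (on_edge h (e, True)))"

definition reduced :: "'e dart list \<Rightarrow> bool" where
  "reduced p \<longleftrightarrow> successively (\<lambda>x y. y \<noteq> bar x) p"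

definition immersed_on_edges :: "('v, 'e) graph \<Rightarrow> ('v, 'e) gmap \<Rightarrow> bool" where
  "immersed_on_edges G' h \<longleftrightarrow> (\<forall>a\<in>arcs G'. on_edge h a \<noteq> [] \<and> reduced (on_edge h a))"

abbreviation common_initial_path :: "('v, 'e) gmap \<Rightarrow> 'e dart \<Rightarrow> 'e dart \<Rightarrow> 'e dart list" where
  "common_initial_path h a b \<equiv> longest_common_prefix (on_edge h a) (on_edge h b)"

definition tight :: "('v, 'e) graph \<Rightarrow> ('v, 'e) gmap \<Rightarrow> bool" where
  "tight G' h \<longleftrightarrow> immersed_on_edges G' h \<and>
     (\<forall>v\<in>verts G'. \<exists>a\<in>out_arcs G' v. \<exists>b\<in>out_arcs G' v. a \<noteq> b \<and> common_initial_path h a b = [])"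

definition immersion :: "('v, 'e) graph \<Rightarrow> ('v, 'e) gmap \<Rightarrow> bool" where
  "immersion G' h \<longleftrightarrow> immersed_on_edges G' h \<and>
     (\<forall>v\<in>verts G'. \<forall>a\<in>out_arcs G' v. \<forall>b\<in>out_arcs G' v.
        a \<noteq> b \<longrightarrow> common_initial_path h a b = [])"


section \<open>Cyclic words\<close>

text \<open>An edge loop is a list of darts, read cyclically.\<close>

definition cyc_reduced :: "'e dart list \<Rightarrow> bool" where
  "cyc_reduced w \<longleftrightarrow> reduced (w @ take 1 w)"

definition cyc_cancel :: "'e dart list \<Rightarrow> 'e dart list \<Rightarrow> bool" where
  "cyc_cancel w w' \<longleftrightarrow> (\<exists>r d. rotate r w = [d, bar d] @ w')"

definition tightens_to :: "'e dart list \<Rightarrow> 'e dart list \<Rightarrow> bool" where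
  "tightens_to w w' \<longleftrightarrow> cyc_cancel\<^sup>*\<^sup>* w w' \<and> cyc_reduced w'"

definition adjacent_in :: "'e dart list \<Rightarrow> 'e dart \<Rightarrow> 'e dart \<Rightarrow> bool" where
  "adjacent_in w a b \<longleftrightarrow>
     (\<exists>r z. rotate r w = [bar a, b] @ z \<or> rotate r w = [bar b, a] @ z)"


section \<open>The once-punctured surface and its spine\<close>

text \<open>
  The word \<open>\<sigma>\<close> is spelled along the unit circle, its \<open>j\<close>-th letter
  along the \<open>j\<close>-th of \<open>length \<sigma>\<close> equal arcs. The cone over the circle without
  its cone point is the punctured closed disc.
\<close>

definition circle_point :: "'e dart list \<Rightarrow> real \<Rightarrow> complex" where
  "circle_point \<sigma> x = cis (2 * pi * x / real (length \<sigma>))"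

abbreviation punctured_disc :: "complex set" where
  "punctured_disc \<equiv> cball 0 1 - {0}"

definition glued :: "'e dart list \<Rightarrow> (complex \<times> complex) set" where
  "glued \<sigma> = {(circle_point \<sigma> (real j + t), circle_point \<sigma> (real j' + 1 - t)) | j j' t.
      j < length \<sigma> \<and> j' < length \<sigma> \<and> \<sigma> ! j' = bar (\<sigma> ! j) \<and> 0 \<le> t \<and> t \<le> 1}"

text \<open>
  \<open>S\<close> is the quotient of the punctured disc by these identifications, and the graph is the
  image of the unit circle, whose corners are identified exactly as prescribed by \<open>G\<close>.
  Since every edge occurs once in each direction, \<open>S\<close> is an oriented surface.
\<close>

definition surface_with_spine ::
  "'s::topological_space set \<Rightarrow> (complex \<Rightarrow> 's) \<Rightarrow> ('v, 'e) graph \<Rightarrow> 'e dart list \<Rightarrow> bool" where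
  "surface_with_spine S q G \<sigma> \<longleftrightarrow>
     \<sigma> \<noteq> [] \<and> cyc_reduced \<sigma> \<and> distinct \<sigma> \<and> set \<sigma> = arcs G \<and>
     pre_digraph.awalk G (tail G (hd \<sigma>)) \<sigma> (tail G (hd \<sigma>)) \<and>
     verts G = tail G ` arcs G \<and>
     quotient_map (top_of_set punctured_disc) (top_of_set S) q \<and>
     (\<forall>z\<in>punctured_disc. \<forall>w\<in>punctured_disc. q z = q w \<longleftrightarrow> (z, w) \<in> (glued \<sigma>)\<^sup>*) \<and>
     (\<forall>j<length \<sigma>. \<forall>j'<length \<sigma>.
        q (circle_point \<sigma> (real j)) = q (circle_point \<sigma> (real j')) \<longleftrightarrow>
        tail G (\<sigma> ! j) = tail G (\<sigma> ! j'))"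

text \<open>
  Filling in the puncture gives a closed oriented surface with a cell structure whose 1-skeleton is
  \<open>G\<close> and which has one 2-cell; its genus \<open>g\<close> is defined by
  Euler characteristic \<open>2 - 2 * g\<close>.
\<close>

definition once_punctured_genus :: "('v, 'e) graph \<Rightarrow> nat \<Rightarrow> bool" where
  "once_punctured_genus G g \<longleftrightarrow>
     int (card (verts G)) - int (card (edges G)) + 1 = 2 - 2 * int g"

abbreviation spine :: "(complex \<Rightarrow> 's) \<Rightarrow> 's set" where
  "spine q \<equiv> q ` sphere 0 1"


section \<open>Products of Dehn twists\<close>

text \<open>
  The embedding \<open>\<alpha>\<close> may have either orientation, so this covers left and right twists.
\<close>

definition dehn_twist :: "'s::topological_space set \<Rightarrow> ('s \<Rightarrow> 's) \<Rightarrow> bool" where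
  "dehn_twist S T \<longleftrightarrow>
     (\<exists>\<alpha> \<beta>. let A = {z::complex. 1 \<le> norm z \<and> norm z \<le> 2} in
        \<alpha> ` A \<subseteq> S \<and> homeomorphism A (\<alpha> ` A) \<alpha> \<beta> \<and>
        (\<forall>z\<in>A. T (\<alpha> z) = \<alpha> (z * cis (2 * pi * (norm z - 1)))) \<and>
        (\<forall>x\<in>S - \<alpha> ` A. T x = x))"

definition dehn_twist_product :: "'s::topological_space set \<Rightarrow> ('s \<Rightarrow> 's) \<Rightarrow> bool" where
  "dehn_twist_product S \<phi> \<longleftrightarrow> (\<exists>\<psi>. homeomorphism S S \<phi> \<psi>) \<and>
     (\<exists>Ts. (\<forall>T\<in>set Ts. dehn_twist S T) \<and> (\<forall>x\<in>S. \<phi> x = foldr (\<circ>) Ts id x))"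


section \<open>Graph maps representing a surface homeomorphism\<close>

text \<open>The point at parameter \<open>x \<in> [0, 1]\<close> on the edge \<open>d\<close> of the spine.\<close>

definition edge_point :: "(complex \<Rightarrow> 's) \<Rightarrow> 'e dart list \<Rightarrow> 'e dart \<Rightarrow> real \<Rightarrow> 's" where
  "edge_point q \<sigma> d x = q (circle_point \<sigma> (real (THE j. j < length \<sigma> \<and> \<sigma> ! j = d) + x))"

text \<open>
  The point at parameter \<open>t \<in> [0, 1]\<close> on a nonempty edge path traversed at constant speed.
  (Edge images of tight maps are nonempty.)
\<close>

definition path_point :: "(complex \<Rightarrow> 's) \<Rightarrow> 'e dart list \<Rightarrow> 'e dart list \<Rightarrow> real \<Rightarrow> 's" where
  "path_point q \<sigma> p t =
     (let x = t * real (length p); i = min (nat \<lfloor>x\<rfloor>) (length p - 1)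
      in edge_point q \<sigma> (p ! i) (x - real i))"

definition realizes :: "(complex \<Rightarrow> 's) \<Rightarrow> 'e dart list \<Rightarrow> ('v, 'e) gmap \<Rightarrow> ('s \<Rightarrow> 's) \<Rightarrow> bool" where
  "realizes q \<sigma> f F \<longleftrightarrow>
     (\<forall>d\<in>set \<sigma>. \<forall>t\<in>{0..1}. F (edge_point q \<sigma> d t) = path_point q \<sigma> (on_edge f d) t)"

definition homotopy_equivalence_of :: "'s::topological_space set \<Rightarrow> ('s \<Rightarrow> 's) \<Rightarrow> bool" where
  "homotopy_equivalence_of X F \<longleftrightarrow> continuous_on X F \<and> F ` X \<subseteq> X \<and>
     (\<exists>H. continuous_on X H \<and> H ` X \<subseteq> X \<and>
        homotopic_with_canon (\<lambda>_. True) X X (H \<circ> F) id \<and>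
        homotopic_with_canon (\<lambda>_. True) X X (F \<circ> H) id)"

text \<open>
  \<open>F\<close> and \<open>\<phi>\<close> agree on fundamental groups up to the change of base point
  along \<open>\<gamma>\<close>. Loops in the spine suffice, its inclusion in \<open>S\<close> being a
  homotopy equivalence.
\<close>

definition same_outer_automorphism ::
  "'s::topological_space set \<Rightarrow> 's set \<Rightarrow> ('s \<Rightarrow> 's) \<Rightarrow> ('s \<Rightarrow> 's) \<Rightarrow> bool" where
  "same_outer_automorphism S \<Gamma> F \<phi> \<longleftrightarrow>
     (\<exists>x\<in>\<Gamma>. \<exists>\<gamma>. path \<gamma> \<and> path_image \<gamma> \<subseteq> S \<and> pathstart \<gamma> = F x \<and> pathfinish \<gamma> = \<phi> x \<and>
        (\<forall>\<alpha>. path \<alpha> \<and> path_image \<alpha> \<subseteq> \<Gamma> \<and> pathstart \<alpha> = x \<and> pathfinish \<alpha> = x \<longrightarrow>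
           homotopic_paths S (\<phi> \<circ> \<alpha>) (reversepath \<gamma> +++ (F \<circ> \<alpha>) +++ \<gamma>)))"

definition homotopy_equivalence_representing ::
  "'s::topological_space set \<Rightarrow> (complex \<Rightarrow> 's) \<Rightarrow> 'e dart list \<Rightarrow> ('v, 'e) gmap \<Rightarrow> ('s \<Rightarrow> 's) \<Rightarrow> bool" where
  "homotopy_equivalence_representing S q \<sigma> f \<phi> \<longleftrightarrow>
     (\<exists>F. realizes q \<sigma> f F \<and> homotopy_equivalence_of (spine q) F \<and>
          same_outer_automorphism S (spine q) F \<phi>)"


section \<open>Subdividing and folding\<close>

text \<open>
  \<open>G\<close> is the codomain of all maps. \<open>initial_edge G k a a1 s G' h G'' h''\<close>:
  the initial part of \<open>a\<close> that \<open>h\<close> sends to the first \<open>k\<close> edges of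
  its image becomes the edge \<open>a1\<close>, subdividing \<open>a\<close> at a new vertex \<open>x\<close>
  unless this part is all of \<open>a\<close>; \<open>s\<close> is the effect on edges. New vertices and
  edges receive arbitrary unused names.
\<close>

definition split_graph :: "'v \<Rightarrow> 'e dart \<Rightarrow> 'e dart \<Rightarrow> 'e dart \<Rightarrow> ('v, 'e) graph \<Rightarrow> ('v, 'e) graph" where
  "split_graph x a a1 a2 H =
     \<lparr> verts = insert x (verts H),
       arcs = (arcs H - {a, bar a}) \<union> {a1, bar a1, a2, bar a2},
       tail = (tail H)(a1 := tail H a, bar a1 := x, a2 := x, bar a2 := head H a),
       head = (head H)(a1 := x, bar a1 := tail H a, a2 := head H a, bar a2 := x) \<rparr>"

definition split_gmap :: "('v, 'e) graph \<Rightarrow> nat \<Rightarrow> 'v \<Rightarrow> 'e dart \<Rightarrow> 'e dart \<Rightarrow> 'e dart \<Rightarrow> ('v, 'e) gmap \<Rightarrow> ('v, 'e) gmap" where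
  "split_gmap G k x a a1 a2 h =
     (let p = take k (on_edge h a); r = drop k (on_edge h a) in
     \<lparr> on_vertex = (on_vertex h)(x := head G (last p)),
       on_edge = (on_edge h)(a1 := p, bar a1 := bar_path p, a2 := r, bar a2 := bar_path r) \<rparr>)"

definition split_dart :: "'e dart \<Rightarrow> 'e dart \<Rightarrow> 'e dart \<Rightarrow> 'e dart \<Rightarrow> 'e dart list" where
  "split_dart a a1 a2 d =
     (if d = a then [a1, a2] else if d = bar a then [bar a2, bar a1] else [d])"

definition initial_edge ::
  "('v, 'e) graph \<Rightarrow> nat \<Rightarrow> 'e dart \<Rightarrow> 'e dart \<Rightarrow> ('e dart \<Rightarrow> 'e dart list) \<Rightarrow>
   ('v, 'e) graph \<Rightarrow> ('v, 'e) gmap \<Rightarrow> ('v, 'e) graph \<Rightarrow> ('v, 'e) gmap \<Rightarrow> bool" where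
  "initial_edge G k a a1 s G' h G'' h'' \<longleftrightarrow> a \<in> arcs G' \<and>
     (k = length (on_edge h a) \<and> a1 = a \<and> s = (\<lambda>d. [d]) \<and> G'' = G' \<and> h'' = h \<or>
      0 < k \<and> k < length (on_edge h a) \<and>
      (\<exists>x a2. x \<notin> verts G' \<and> fst a1 \<notin> edges G' \<and> fst a2 \<notin> edges G' \<and> fst a1 \<noteq> fst a2 \<and>
         s = split_dart a a1 a2 \<and> G'' = split_graph x a a1 a2 G' \<and>
         h'' = split_gmap G k x a a1 a2 h))"

definition subst_word :: "('e dart \<Rightarrow> 'e dart list) \<Rightarrow> 'e dart list \<Rightarrow> 'e dart list" where
  "subst_word s w = concat (map s w)"

text \<open>
  The step from \<open>G\<^bsub>2i\<^esub>\<close> to \<open>G\<^bsub>2i+1\<^esub>\<close>, where \<open>h\<close> is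
  \<open>g\<^bsub>i\<^esub>\<close> and \<open>h'\<close> is the map induced on \<open>G\<^bsub>2i+1\<^esub>\<close>.
\<close>

definition subdivide_step ::
  "('v, 'e) graph \<Rightarrow> 'e dart \<Rightarrow> 'e dart \<Rightarrow> 'e dart \<Rightarrow> 'e dart \<Rightarrow> ('e dart \<Rightarrow> 'e dart list) \<Rightarrow>
   ('v, 'e) graph \<Rightarrow> ('v, 'e) gmap \<Rightarrow> 'e dart list \<Rightarrow>
   ('v, 'e) graph \<Rightarrow> ('v, 'e) gmap \<Rightarrow> 'e dart list \<Rightarrow> bool" where
  "subdivide_step G a b a1 b1 s H h w H' h' w' \<longleftrightarrow>
     a \<in> arcs H \<and> b \<in> arcs H \<and> a \<noteq> b \<and> tail H a = tail H b \<and> adjacent_in w a b \<and>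
     common_initial_path h a b \<noteq> [] \<and>
     (\<exists>H1 h1 s1 s2. let k = length (common_initial_path h a b) in
        initial_edge G k a a1 s1 H h H1 h1 \<and> initial_edge G k b b1 s2 H1 h1 H' h' \<and>
        s = (\<lambda>d. subst_word s2 (s1 d))) \<and>
     w' = subst_word s w"

text \<open>The image of the folded edges keeps the name \<open>a1\<close>, and that of their terminal points
  the name of the terminal point of \<open>a1\<close>. Then the induced map is given by the same
  values as before.\<close>

definition fold_dart :: "'e dart \<Rightarrow> 'e dart \<Rightarrow> 'e dart \<Rightarrow> 'e dart" where
  "fold_dart a1 b1 d = (if d = b1 then a1 else if d = bar b1 then bar a1 else d)"

definition folded_graph :: "'e dart \<Rightarrow> 'e dart \<Rightarrow> ('v, 'e) graph \<Rightarrow> ('v, 'e) graph" where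
  "folded_graph a1 b1 H =
     (let m = (\<lambda>v. if v = head H b1 then head H a1 else v) in
     \<lparr> verts = m ` verts H, arcs = arcs H - {b1, bar b1}, tail = m \<circ> tail H, head = m \<circ> head H \<rparr>)"

definition fold_step ::
  "'e dart \<Rightarrow> 'e dart \<Rightarrow> ('v, 'e) graph \<Rightarrow> ('v, 'e) gmap \<Rightarrow> 'e dart list \<Rightarrow>
   ('v, 'e) graph \<Rightarrow> ('v, 'e) gmap \<Rightarrow> 'e dart list \<Rightarrow> bool" where
  "fold_step a1 b1 H h w H' h' w' \<longleftrightarrow>
     H' = folded_graph a1 b1 H \<and> h' = h \<and> tightens_to (map (fold_dart a1 b1) w) w'"


section \<open>Triangulating the annuli\<close>

text \<open>
  Vertices are pairs (level, position): level \<open>l\<close> carries the word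
  \<open>\<sigma>\<^bsub>l\<^esub>\<close>, and position \<open>j\<close> is the initial point of its
  \<open>j\<close>-th letter. A triangle is listed as three vertices; a pair of lists in a pairing
  matches the two triangles with vertices corresponding in the listed order.
\<close>

type_synonym vertex = "nat \<times> nat"
type_synonym pairing = "(vertex list \<times> vertex list) set"

text \<open>
  Triangulations of a polygon without additional vertices, by cutting off ears. Any polygon with
  more than three sides has an ear whose tip is neither the first nor the last listed vertex, so
  every such triangulation is obtained.
\<close>

inductive triangulates :: "'a list \<Rightarrow> 'a list set \<Rightarrow> bool" where
  triangle: "triangulates [x, y, z] {[x, y, z]}"
| ear: "triangulates (us @ [x, z] @ ws) T \<Longrightarrow> triangulates (us @ [x, y, z] @ ws) (insert [x, y, z] T)"

text \<open>
  The polygon between the bottom edge from \<open>P j\<close> to \<open>P (j + 1)\<close> and the top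
  path from \<open>Q t\<close> to \<open>Q (t + n)\<close>, and the same polygon listed in the way that
  corresponds to the polygon of the oppositely oriented edge.
\<close>

definition polygon :: "(nat \<Rightarrow> vertex) \<Rightarrow> (nat \<Rightarrow> vertex) \<Rightarrow> nat \<Rightarrow> nat \<Rightarrow> nat \<Rightarrow> vertex list" where
  "polygon P Q j t n = [P j, P (j + 1)] @ rev (map Q [t..<t + n + 1])"

definition opposite_polygon :: "(nat \<Rightarrow> vertex) \<Rightarrow> (nat \<Rightarrow> vertex) \<Rightarrow> nat \<Rightarrow> nat \<Rightarrow> nat \<Rightarrow> vertex list" where
  "opposite_polygon P Q j t n = [P (j + 1), P j] @ map Q [t..<t + n + 1]"

definition paired_polygons :: "nat list set \<Rightarrow> vertex list \<Rightarrow> vertex list \<Rightarrow> pairing" where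
  "paired_polygons T ps ps' = (\<lambda>is. (map ((!) ps) is, map ((!) ps') is)) ` T"

definition on_level :: "nat \<Rightarrow> 'e dart list \<Rightarrow> nat \<Rightarrow> nat \<Rightarrow> vertex" where
  "on_level l w r j = (l, (r + j) mod length w)"

text \<open>
  \<open>E e\<close> is the chosen triangulation pattern of the two polygons belonging to the edge
  \<open>e\<close>; the pattern is read off in the positive direction of \<open>e\<close> for one of them
  and in the negative direction for the other.
\<close>

definition subdivision_annulus :: "nat \<Rightarrow> ('e dart \<Rightarrow> 'e dart list) \<Rightarrow> 'e dart list \<Rightarrow> pairing \<Rightarrow> bool" where
  "subdivision_annulus l s w A \<longleftrightarrow>
     (\<exists>E. let P = on_level l w 0; Q = on_level (l + 1) (subst_word s w) 0;
              top = (\<lambda>j. length (subst_word s (take j w))); n = (\<lambda>j. length (s (w ! j))) in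
        (\<forall>j<length w. triangulates [0..<n j + 3] (E (fst (w ! j)))) \<and>
        A = (\<Union>{paired_polygons (E (fst (w ! j)))
                  (polygon P Q j (top j) (n j)) (opposite_polygon P Q j' (top j') (n j')) | j j'.
                j < length w \<and> j' < length w \<and> snd (w ! j) \<and> w ! j' = bar (w ! j)}))"

text \<open>
  In the fold annulus, \<open>\<alpha>\<close> and \<open>\<beta>\<close> are the folded edges oriented towards
  their common endpoint, so that \<open>\<alpha>\<close> followed by \<open>bar \<beta>\<close> occurs in the word
  \<open>w\<close>. Positions are counted from the beginning of this subpath, along the rotation
  \<open>v\<close> of \<open>w\<close>; in the word \<open>w'\<close> they are counted from the
  corresponding place, so that the letter at position \<open>j \<ge> 2\<close> corresponds to the
  letter at position \<open>j - 2\<close>.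
\<close>

definition fold_rectangles ::
  "(nat \<Rightarrow> vertex) \<Rightarrow> (nat \<Rightarrow> vertex) \<Rightarrow> 'e dart list \<Rightarrow> 'e set \<Rightarrow> ('e \<Rightarrow> nat list set) \<Rightarrow> pairing" where
  "fold_rectangles P Q v X E =
     (\<Union>{paired_polygons (E (fst (v ! j)))
           (polygon P Q j (j - 2) 1) (opposite_polygon P Q j' (j' - 2) 1) | j j'.
         j < length v \<and> j' < length v \<and> fst (v ! j) \<notin> X \<and> snd (v ! j) \<and> v ! j' = bar (v ! j)})"

text \<open>The subpath \<open>\<alpha> \<beta>\<inverse> u \<alpha>\<inverse>\<close>; \<open>q\<close> is the position of the
  other occurrence of \<open>\<beta>\<close>.\<close>

definition fold_triangles_1 :: "(nat \<Rightarrow> vertex) \<Rightarrow> (nat \<Rightarrow> vertex) \<Rightarrow> nat \<Rightarrow> nat \<Rightarrow> nat \<Rightarrow> pairing" where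
  "fold_triangles_1 P Q m k q =
     (let R0 = P q; R1 = P (q + 1); S0 = Q (q - 2); S1 = Q (q - 1) in
      {([P 0, P 1, Q 0], [P (m + 1), P m, Q (k + 1)]),
       ([P 1, P 2, Q 0], [R1, R0, S0]),
       ([P m, Q k, Q (k + 1)], [R1, S1, S0])})"

text \<open>The subpath \<open>\<alpha> \<beta>\<inverse> u \<beta>\<close>; \<open>q\<close> is the position of the
  other occurrence of \<open>\<alpha>\<inverse>\<close>.\<close>

definition fold_triangles_2 :: "(nat \<Rightarrow> vertex) \<Rightarrow> (nat \<Rightarrow> vertex) \<Rightarrow> nat \<Rightarrow> nat \<Rightarrow> nat \<Rightarrow> pairing" where
  "fold_triangles_2 P Q m k q =
     (let R0 = P q; R1 = P (q + 1); S0 = Q (q - 2); S1 = Q (q - 1) in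
      {([P 1, P 2, Q 0], [P (m + 1), P m, Q k]),
       ([P 0, P 1, Q 0], [R1, R0, S1]),
       ([P (m + 1), Q k, Q (k + 1)], [R0, S1, S0])})"

definition fold_annulus ::
  "nat \<Rightarrow> 'e dart \<Rightarrow> 'e dart \<Rightarrow> 'e dart list \<Rightarrow> 'e dart list \<Rightarrow> pairing \<Rightarrow> bool" where
  "fold_annulus l a1 b1 w w' A \<longleftrightarrow>
     (\<exists>\<alpha> \<beta> r r' v u c z q E.
        let P = on_level l w r; Q = on_level (l + 1) w' r'; k = length u; m = k + 2 in
        {\<alpha>, \<beta>} = {bar a1, bar b1} \<and>
        v = rotate r w \<and> v = [\<alpha>, bar \<beta>] @ u @ [c] @ z \<and>
        (\<forall>d\<in>set u. fst d \<noteq> fst \<alpha> \<and> fst d \<noteq> fst \<beta>) \<and>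
        rotate r' w' = map (fold_dart a1 b1) (u @ [c] @ z) \<and>
        m < q \<and> q < length v \<and>
        (\<forall>e. triangulates [0..<4] (E e)) \<and>
        (c = bar \<alpha> \<and> v ! q = \<beta> \<and>
           A = fold_rectangles P Q v {fst \<alpha>, fst \<beta>} E \<union> fold_triangles_1 P Q m k q \<or>
         c = \<beta> \<and> v ! q = bar \<alpha> \<and>
           A = fold_rectangles P Q v {fst \<alpha>, fst \<beta>} E \<union> fold_triangles_2 P Q m k q))"


section \<open>The triangulated torus and the ideal triangulation of the mapping torus\<close>

text \<open>
  The annuli are already glued along the words of the levels between them; the map \<open>seam\<close>
  identifies the last level with level \<open>0\<close>. All words being longer than two,
  a triangle is determined by its vertices before this last identification.
\<close>

record torus =
  triangles :: "vertex set set"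
  seam :: "vertex \<Rightarrow> vertex"
  face_pairing :: pairing

text \<open>
  Tetrahedra are cones over triangles, with ideal vertex \<^const>\<open>None\<close>. Cones over triangles
  with a common edge share a face; the remaining faces are glued, with vertices corresponding in the
  listed order, by the face pairing and along the seam.
\<close>

record ideal_triangulation =
  tetrahedra :: "vertex option set set"
  gluings :: "(vertex option list \<times> vertex option list) set"

definition cone_triangulation :: "torus \<Rightarrow> ideal_triangulation" where
  "cone_triangulation K =
     \<lparr> tetrahedra = (\<lambda>t. insert None (Some ` t)) ` triangles K,
       gluings = (\<lambda>(t, t'). (map Some t, map Some t')) ` face_pairing K \<union>
         {([None, Some x, Some y], [None, Some (seam K x), Some (seam K y)]) | x y t.
            t \<in> triangles K \<and> x \<in> t \<and> y \<in> t \<and> x \<noteq> y \<and> seam K x \<noteq> x \<and> seam K y \<noteq> y} \<rparr>"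

text \<open>
  \<open>Gs l\<close>, \<open>ws l\<close> and \<open>As l\<close> are \<open>G\<^bsub>l\<^esub>\<close>,
  \<open>\<sigma>\<^bsub>l\<^esub>\<close> and the pairing on the annulus \<open>A\<^bsub>l\<^esub>\<close>;
  \<open>gs (2 * i)\<close> is \<open>g\<^bsub>i\<^esub>\<close>. The final map carries the last word to a rotation
  of \<open>\<sigma>\<close>, which gives the gluing of the two ends. The construction involves choices;
  the predicate holds for every possible outcome.
\<close>

definition torus_produced :: "('v, 'e) graph \<Rightarrow> ('v, 'e) gmap \<Rightarrow> 'e dart list \<Rightarrow> torus \<Rightarrow> bool" where
  "torus_produced G f \<sigma> K \<longleftrightarrow>
     (\<exists>n Gs gs ws As r.
        Gs 0 = G \<and> gs 0 = f \<and> ws 0 = \<sigma> \<and>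
        (\<forall>i<n. \<not> immersion (Gs (2 * i)) (gs (2 * i)) \<and>
           (\<exists>a b a1 b1 s.
              subdivide_step G a b a1 b1 s (Gs (2 * i)) (gs (2 * i)) (ws (2 * i))
                (Gs (2 * i + 1)) (gs (2 * i + 1)) (ws (2 * i + 1)) \<and>
              fold_step a1 b1 (Gs (2 * i + 1)) (gs (2 * i + 1)) (ws (2 * i + 1))
                (Gs (2 * i + 2)) (gs (2 * i + 2)) (ws (2 * i + 2)) \<and>
              subdivision_annulus (2 * i) s (ws (2 * i)) (As (2 * i)) \<and>
              fold_annulus (2 * i + 1) a1 b1 (ws (2 * i + 1)) (ws (2 * i + 2)) (As (2 * i + 1)))) \<and>
        immersion (Gs (2 * n)) (gs (2 * n)) \<and>
        subst_word (on_edge (gs (2 * n))) (ws (2 * n)) = rotate r \<sigma> \<and>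
        K = \<lparr> triangles = (\<Union>l<2 * n. \<Union>(t, t')\<in>As l. {set t, set t'}),
              seam = (\<lambda>(l, j). if l = 2 * n then (0, (r + j) mod length \<sigma>) else (l, j)),
              face_pairing = (\<Union>l<2 * n. As l) \<rparr>)"

definition triangulation_produced ::
  "('v, 'e) graph \<Rightarrow> ('v, 'e) gmap \<Rightarrow> 'e dart list \<Rightarrow> ideal_triangulation \<Rightarrow> bool" where
  "triangulation_produced G f \<sigma> \<T> \<longleftrightarrow> (\<exists>K. torus_produced G f \<sigma> K \<and> \<T> = cone_triangulation K)"

end

theory Submission
  imports Defs
begin

text \<open>
  The number of tetrahedra is the number of rounds, each consisting of a subdivision and a fold,
  times the number of triangles in the two annuli of a round.

  Subdividing does not change the size of the map, and a fold decreases it by the length of the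
  common initial path. So there are at most \<open>S(f)\<close> rounds.

  Counting the triangles letter by letter, an annulus has at most as many of them as the words on its
  two boundary components have letters (\<open>card_subdivision_annulus\<close>,
  \<open>card_fold_annulus\<close>). The words traverse each edge at most once in each direction. So the
  point is to bound the number of edges of the graphs \<open>G\<^bsub>2i\<^esub>\<close> independently of
  \<open>i\<close>. The quantity \<open>D - 2 V\<close>, where \<open>V\<close> is the number of vertices and
  \<open>D\<close> that of oriented edges, never grows and is \<open>4 g - 2\<close> at the beginning. If all
  vertices had valence at least three, then \<open>D \<ge> 3 V\<close> would bound \<open>V\<close> and
  \<open>D\<close>. The valence can drop to two, however, when two of three edges at a vertex are folded.

  The number of gates of a vertex, that is, of different first edges of the images of the edges at
  this vertex, does not have this defect: a fold at a vertex does not remove any of its gates. Tightness means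
  that every vertex has at least two gates, and where there are three or more, the valence is at
  least three. It turns out that the number of vertices with exactly two gates never grows
  (\<open>few_gates_fold\<close>): when both edges are subdivided, the new vertex has three gates because the
  common initial path is maximal, and otherwise the new vertex inherits the gates of an old one.
  Since all vertices of \<open>G\<close> have valence at least three, there are at most
  \<open>4 g - 2\<close> of them, hence never more than \<open>4 g - 2\<close> vertices with two gates.
  This yields \<open>D \<le> 2 (4 g - 2) + 3 (4 g - 2) = 20 g - 10\<close> in \<open>card_arcs_le\<close> and
  at most \<open>4 D + 4 \<le> 16 (5 g - 2)\<close> triangles in each round.
\<close>

section \<open>Darts and edge paths\<close>

lemma bar_bar [simp]: "bar (bar a) = a"
  by (simp add: bar_def)

lemma bar_neq [simp]: "bar a \<noteq> a" "a \<noteq> bar a"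
  by (auto simp: bar_def prod_eq_iff)

lemma fst_bar [simp]: "fst (bar a) = fst a"
  by (simp add: bar_def)

lemma snd_bar [simp]: "snd (bar a) \<longleftrightarrow> \<not> snd a"
  by (simp add: bar_def)

lemma bar_eq_iff [simp]: "bar a = bar b \<longleftrightarrow> a = b"
  by (metis bar_bar)

lemma bar_eq_swap: "bar a = b \<longleftrightarrow> a = bar b"
  by auto

lemma fst_eq_iff_bar: "fst a = fst b \<longleftrightarrow> a = b \<or> a = bar b"
  by (cases a; cases b) (auto simp: bar_def)

lemma bar_path_eq_Nil_iff [simp]: "bar_path p = [] \<longleftrightarrow> p = []"
  by (simp add: bar_path_def)

lemma bar_path_bar_path [simp]: "bar_path (bar_path p) = p"
  by (simp add: bar_path_def rev_map o_def)

lemma length_bar_path [simp]: "length (bar_path p) = length p"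
  by (simp add: bar_path_def)

lemma bar_path_append: "bar_path (p @ q) = bar_path q @ bar_path p"
  by (simp add: bar_path_def)

lemma hd_bar_path: "p \<noteq> [] \<Longrightarrow> hd (bar_path p) = bar (last p)"
  by (simp add: bar_path_def hd_rev last_map)

lemma reduced_append_iff:
  "reduced (p @ q) \<longleftrightarrow> reduced p \<and> reduced q \<and> (p \<noteq> [] \<longrightarrow> q \<noteq> [] \<longrightarrow> hd q \<noteq> bar (last p))"
  by (auto simp: reduced_def successively_append_iff)

lemma reduced_bar_path [simp]: "reduced (bar_path p) \<longleftrightarrow> reduced p"
proof -
  have "reduced p" if "reduced (bar_path p)" for p :: "'a dart list"
    using that
    by (auto simp: reduced_def bar_path_def successively_map elim!: successively_mono)
  from this[of p] this[of "bar_path p"] show ?thesis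
    by auto
qed

text \<open>
  In a path that equals its reverse, the middle edge would be its own reverse if the length is odd,
  and the two middle edges would cancel if it is even.
\<close>

lemma bar_path_neq_self:
  assumes "reduced p" "p \<noteq> []"
  shows "bar_path p \<noteq> p"
proof
  assume eq: "bar_path p = p"
  define n where "n = length p"
  have nth: "p ! i = bar (p ! (n - 1 - i))" if "i < n" for i
  proof -
    have "p ! i = bar_path p ! i"
      by (simp add: eq)
    also have "\<dots> = bar (p ! (n - 1 - i))"
      using that by (simp add: bar_path_def rev_nth n_def)
    finally show ?thesis .
  qed
  have "n > 0"
    using assms(2) by (simp add: n_def)
  show False
  proof (cases "even n")
    case True
    then obtain m where m: "n = 2 * m"
      by blast
    with \<open>n > 0\<close> have "m > 0"
      by simp
    have "Suc (m - 1) < length p"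
      using m \<open>m > 0\<close> by (simp add: n_def)
    then have "p ! Suc (m - 1) \<noteq> bar (p ! (m - 1))"
      using assms(1) unfolding reduced_def successively_conv_nth by blast
    moreover have "n - 1 - m = m - 1" "m < n"
      using m \<open>m > 0\<close> by auto
    ultimately show False
      using nth[of m] \<open>m > 0\<close> by simp
  next
    case False
    then obtain m where "n = 2 * m + 1"
      by (auto elim: oddE)
    then show False
      using nth[of m] by simp
  qed
qed

lemma longest_common_prefix_eq_take:
  "longest_common_prefix p p' = take (length (longest_common_prefix p p')) p"
  "longest_common_prefix p p' = take (length (longest_common_prefix p p')) p'"
  using longest_common_prefix_prefix1 longest_common_prefix_prefix2
  by (metis append_eq_conv_conj prefix_def)+

lemma longest_common_prefix_eq_Nil_iff:
  "p \<noteq> [] \<Longrightarrow> p' \<noteq> [] \<Longrightarrow> longest_common_prefix p p' = [] \<longleftrightarrow> hd p \<noteq> hd p'"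
  by (cases p; cases p') auto

lemma longest_common_prefix_maximal:
  "length (longest_common_prefix p p') < length p \<Longrightarrow> length (longest_common_prefix p p') < length p' \<Longrightarrow>
   hd (drop (length (longest_common_prefix p p')) p) \<noteq> hd (drop (length (longest_common_prefix p p')) p')"
  by (induction p p' rule: longest_common_prefix.induct) auto

section \<open>Graph maps that are immersed on edges, and their gates\<close>

text \<open>
  The part of tightness that concerns single edges. Subdividing and folding preserve it, whatever
  happens at the vertices, which are the subject of the gates below.
\<close>

locale edge_immersion =
  fixes H :: "('v, 'e) graph" and h :: "('v, 'e) gmap"
  assumes finite_verts: "finite (verts H)"
    and finite_arcs: "finite (arcs H)"
    and tail_in_verts: "a \<in> arcs H \<Longrightarrow> tail H a \<in> verts H"
    and bar_in_arcs: "a \<in> arcs H \<Longrightarrow> bar a \<in> arcs H"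
    and head_conv_tail: "a \<in> arcs H \<Longrightarrow> head H a = tail H (bar a)"
    and on_edge_bar: "a \<in> arcs H \<Longrightarrow> on_edge h (bar a) = bar_path (on_edge h a)"
    and on_edge_nonempty: "a \<in> arcs H \<Longrightarrow> on_edge h a \<noteq> []"
    and on_edge_reduced: "a \<in> arcs H \<Longrightarrow> reduced (on_edge h a)"

text \<open>
  Images of edges being nonempty, two edges at a vertex can be folded if and only if their images
  have the same first edge. So a gate is a class of edges that can be folded with each other, and
  tightness at a vertex means that it has at least two gates.
\<close>

definition gates :: "('v, 'e) graph \<Rightarrow> ('v, 'e) gmap \<Rightarrow> 'v \<Rightarrow> 'e dart set" where
  "gates H h v = (\<lambda>a. hd (on_edge h a)) ` out_arcs H v"

definition total_length :: "('v, 'e) graph \<Rightarrow> ('v, 'e) gmap \<Rightarrow> nat" where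
  "total_length H h = (\<Sum>a\<in>arcs H. length (on_edge h a))"

text \<open>
  This is \<open>-2\<close> times the Euler characteristic, or the sum over all vertices of the
  valence minus two.
\<close>

definition excess :: "('v, 'e) graph \<Rightarrow> int" where
  "excess H = int (card (arcs H)) - 2 * int (card (verts H))"

text \<open>
  In a tight map these are the vertices with exactly two gates. The inequality makes the set
  behave well when vertices are merged, where gates can only be added.
\<close>

definition few_gates :: "('v, 'e) graph \<Rightarrow> ('v, 'e) gmap \<Rightarrow> 'v set" where
  "few_gates H h = {v \<in> verts H. card (gates H h v) \<le> 2}"

context edge_immersion
begin

lemma finite_gates [simp]: "finite (gates H h v)"
  using finite_arcs by (auto simp: gates_def out_arcs_def)

lemma bar_in_arcs_iff [simp]: "bar a \<in> arcs H \<longleftrightarrow> a \<in> arcs H"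
  using bar_in_arcs[of a] bar_in_arcs[of "bar a"] by auto

lemma edge_name_iff: "fst a \<in> edges H \<longleftrightarrow> a \<in> arcs H"
proof
  assume "fst a \<in> edges H"
  then obtain b where "b \<in> arcs H" "fst a = fst b"
    by (auto simp: edges_def)
  then show "a \<in> arcs H"
    by (auto simp: fst_eq_iff_bar)
qed (auto simp: edges_def)

lemma arcs_conv_edges: "arcs H = edges H \<times> UNIV"
  using edge_name_iff by fastforce

lemma card_arcs: "card (arcs H) = 2 * card (edges H)"
  by (simp add: arcs_conv_edges card_cartesian_product)

lemma total_length_eq: "total_length H h = 2 * map_size H h"
proof -
  have "total_length H h = (\<Sum>e\<in>edges H. \<Sum>b\<in>UNIV. length (on_edge h (e, b)))"
    unfolding total_length_def arcs_conv_edges by (simp add: sum.cartesian_product)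
  also have "\<dots> = (\<Sum>e\<in>edges H. 2 * length (on_edge h (e, True)))"
  proof (rule sum.cong)
    fix e assume "e \<in> edges H"
    then have "(e, True) \<in> arcs H"
      using edge_name_iff[of "(e, True)"] by simp
    then have "length (on_edge h (e, False)) = length (on_edge h (e, True))"
      using on_edge_bar[of "(e, True)"] by (simp add: bar_def)
    then show "(\<Sum>b\<in>UNIV. length (on_edge h (e, b))) = 2 * length (on_edge h (e, True))"
      by (simp add: UNIV_bool)
  qed simp
  finally show ?thesis
    by (simp add: map_size_def sum_distrib_left)
qed

lemma sum_card_out_arcs: "(\<Sum>v\<in>verts H. card (out_arcs H v)) = card (arcs H)"
proof -
  have "card (arcs H) = card (\<Union>v\<in>verts H. out_arcs H v)"
    by (rule arg_cong[of _ _ card]) (auto simp: tail_in_verts)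
  also have "\<dots> = (\<Sum>v\<in>verts H. card (out_arcs H v))"
    by (rule card_UN_disjoint) (auto simp: finite_verts finite_arcs out_arcs_def)
  finally show ?thesis ..
qed

lemma card_gates_le: "card (gates H h v) \<le> card (out_arcs H v)"
  using finite_arcs by (auto simp: gates_def out_arcs_def intro: card_image_le)

text \<open>
  The valence of a vertex is at least its number of gates, hence at least three outside
  \<open>few_gates\<close>. If there are \<open>V\<close> vertices, \<open>D\<close> darts and \<open>N\<close>
  vertices with two gates, then \<open>3 V - N \<le> D\<close>. Eliminating \<open>V\<close> by means of
  the excess \<open>D - 2 V\<close> gives the bound.
\<close>

lemma card_arcs_le:
  assumes "\<And>v. v \<in> verts H \<Longrightarrow> card (gates H h v) \<ge> 2"
  shows "int (card (arcs H)) \<le> 2 * int (card (few_gates H h)) + 3 * excess H"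
proof -
  have sub: "few_gates H h \<subseteq> verts H"
    by (auto simp: few_gates_def)
  then have fin: "finite (few_gates H h)"
    using finite_verts finite_subset by blast
  have "2 * card (few_gates H h) + 3 * card (verts H - few_gates H h)
      \<le> (\<Sum>v\<in>few_gates H h. card (gates H h v)) + (\<Sum>v\<in>verts H - few_gates H h. card (gates H h v))"
  proof (rule add_mono)
    show "2 * card (few_gates H h) \<le> (\<Sum>v\<in>few_gates H h. card (gates H h v))"
      using sum_mono[of "few_gates H h" "\<lambda>_. 2" "\<lambda>v. card (gates H h v)"] assms sub
      by (auto simp: mult.commute)
    have "(\<Sum>v\<in>verts H - few_gates H h. 3) \<le> (\<Sum>v\<in>verts H - few_gates H h. card (gates H h v))"
      by (intro sum_mono) (auto simp: few_gates_def)
    then show "3 * card (verts H - few_gates H h) \<le> (\<Sum>v\<in>verts H - few_gates H h. card (gates H h v))"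
      by (simp add: mult.commute)
  qed
  also have "\<dots> = (\<Sum>v\<in>verts H. card (gates H h v))"
    using sum.subset_diff[OF sub finite_verts, of "\<lambda>v. card (gates H h v)"] by linarith
  also have "\<dots> \<le> (\<Sum>v\<in>verts H. card (out_arcs H v))"
    by (intro sum_mono card_gates_le)
  also have "\<dots> = card (arcs H)"
    by (rule sum_card_out_arcs)
  finally have "2 * card (few_gates H h) + 3 * (card (verts H) - card (few_gates H h)) \<le> card (arcs H)"
    using card_Diff_subset[OF fin sub] by simp
  moreover have "card (few_gates H h) \<le> card (verts H)"
    using card_mono[OF finite_verts sub] .
  ultimately show ?thesis
    by (simp add: excess_def)
qed

end

section \<open>Subdividing an edge\<close>

locale edge_subdivision = edge_immersion H h
  for H :: "('v, 'e) graph" and h :: "('v, 'e) gmap" +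
  fixes G :: "('v, 'e) graph" and k :: nat and a a1 a2 :: "'e dart" and x :: 'v
  assumes arc: "a \<in> arcs H"
    and pos: "0 < k" and less: "k < length (on_edge h a)"
    and new_vertex: "x \<notin> verts H"
    and new_edges: "fst a1 \<notin> edges H" "fst a2 \<notin> edges H" "fst a1 \<noteq> fst a2"
begin

abbreviation (input) "H' \<equiv> split_graph x a a1 a2 H"
abbreviation (input) "h' \<equiv> split_gmap G k x a a1 a2 h"
abbreviation (input) "p \<equiv> take k (on_edge h a)"
abbreviation (input) "r \<equiv> drop k (on_edge h a)"

lemma new_distinct:
  "a1 \<noteq> a2" "a1 \<noteq> bar a2" "a2 \<noteq> a1" "a2 \<noteq> bar a1" "bar a1 \<noteq> a2" "bar a2 \<noteq> a1"
  using new_edges(3) by auto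

lemma old_distinct:
  assumes "d \<in> arcs H"
  shows "d \<noteq> a1" "d \<noteq> a2" "d \<noteq> bar a1" "d \<noteq> bar a2"
  using assms new_edges edge_name_iff[of a1] edge_name_iff[of a2] by auto

lemma arcs_split: "arcs H' = (arcs H - {a, bar a}) \<union> {a1, bar a1, a2, bar a2}"
  by (simp add: split_graph_def)

lemma verts_split: "verts H' = insert x (verts H)"
  by (simp add: split_graph_def)

lemma tail_split_new: "tail H' a1 = tail H a" "tail H' (bar a1) = x" "tail H' a2 = x"
  "tail H' (bar a2) = head H a"
  using new_distinct by (auto simp: split_graph_def)

lemma head_split_new: "head H' a1 = x" "head H' (bar a1) = tail H a" "head H' a2 = head H a"
  "head H' (bar a2) = x"
  using new_distinct by (auto simp: split_graph_def)

lemma on_edge_split_new: "on_edge h' a1 = p" "on_edge h' (bar a1) = bar_path p" "on_edge h' a2 = r"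
  "on_edge h' (bar a2) = bar_path r"
  using new_distinct by (auto simp: split_gmap_def Let_def)

lemma split_old:
  assumes "d \<in> arcs H"
  shows "tail H' d = tail H d" "head H' d = head H d" "on_edge h' d = on_edge h d"
  using old_distinct[OF assms] by (auto simp: split_graph_def split_gmap_def Let_def)

lemma prefix_rest: "p \<noteq> []" "r \<noteq> []" "p @ r = on_edge h a"
  using pos less by auto

lemma prefix_rest_reduced: "reduced p" "reduced r" "hd r \<noteq> bar (last p)"
  using on_edge_reduced[OF arc] prefix_rest
  by (metis reduced_append_iff)+

sublocale split: edge_immersion H' h'
proof
  fix d assume d: "d \<in> arcs H'"
  have aH: "tail H a \<in> verts H" "head H a \<in> verts H"
    using arc by (auto simp: tail_in_verts head_conv_tail)
  consider "d \<in> arcs H" "d \<noteq> a" "d \<noteq> bar a" | "d = a1" | "d = bar a1" | "d = a2" | "d = bar a2"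
    using d arcs_split by auto
  note cs = this
  show "tail H' d \<in> verts H'"
    by (rule cs)
       (use aH in \<open>auto simp: verts_split tail_split_new split_old tail_in_verts\<close>)
  show "bar d \<in> arcs H'"
    by (rule cs) (auto simp: arcs_split bar_eq_swap)
  show "head H' d = tail H' (bar d)"
    by (rule cs) (auto simp: tail_split_new head_split_new split_old head_conv_tail)
  show "on_edge h' (bar d) = bar_path (on_edge h' d)"
    by (rule cs) (auto simp: on_edge_split_new split_old on_edge_bar)
  show "on_edge h' d \<noteq> []"
    by (rule cs) (use prefix_rest in \<open>auto simp: on_edge_split_new split_old on_edge_nonempty\<close>)
  show "reduced (on_edge h' d)"
    by (rule cs)
       (use prefix_rest_reduced in \<open>auto simp: on_edge_split_new split_old on_edge_reduced\<close>)
qed (auto simp: finite_verts finite_arcs arcs_split verts_split)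

lemma old_new_arcs_disjoint: "(arcs H - {a, bar a}) \<inter> {a1, bar a1, a2, bar a2} = {}"
  using old_distinct(1)[of a1] old_distinct(2)[of a2] old_distinct(3)[of "bar a1"]
    old_distinct(4)[of "bar a2"]
  by (auto simp: arcs_split)

lemma excess_split: "excess H' = excess H"
proof -
  have "card (arcs H') = card (arcs H - {a, bar a}) + card {a1, bar a1, a2, bar a2}"
    unfolding arcs_split using old_new_arcs_disjoint finite_arcs
    by (intro card_Un_disjoint) auto
  also have "card {a1, bar a1, a2, bar a2} = 4"
    using new_distinct by simp
  also have "card (arcs H - {a, bar a}) = card (arcs H) - 2"
    using arc by (subst card_Diff_subset) auto
  finally have "card (arcs H') = card (arcs H) - 2 + 4" .
  moreover have "card {a, bar a} \<le> card (arcs H)"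
    using arc finite_arcs by (intro card_mono) auto
  moreover have "card (verts H') = Suc (card (verts H))"
    using finite_verts new_vertex by (simp add: verts_split)
  ultimately show ?thesis
    by (simp add: excess_def)
qed

lemma total_length_split: "total_length H' h' = total_length H h"
proof -
  let ?l = "\<lambda>d. length (on_edge h d)" and ?l' = "\<lambda>d. length (on_edge h' d)"
  have "total_length H' h' = sum ?l' (arcs H - {a, bar a}) + sum ?l' {a1, bar a1, a2, bar a2}"
    unfolding total_length_def arcs_split using old_new_arcs_disjoint finite_arcs
    by (intro sum.union_disjoint) auto
  also have "sum ?l' {a1, bar a1, a2, bar a2} = 2 * length p + 2 * length r"
    using new_distinct by (simp add: on_edge_split_new)
  also have "\<dots> = 2 * length (p @ r)"
    by (simp only: length_append distrib_left)
  also have "\<dots> = sum ?l {a, bar a}"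
    using arc prefix_rest(3) by (simp add: on_edge_bar)
  also have "sum ?l' (arcs H - {a, bar a}) = sum ?l (arcs H - {a, bar a})"
    by (intro sum.cong) (auto simp: split_old)
  also have "\<dots> + sum ?l {a, bar a} = sum ?l (arcs H)"
    using arc finite_arcs by (intro sum.subset_diff[symmetric]) auto
  finally show ?thesis
    by (simp add: total_length_def)
qed

text \<open>The initial parts of the edge and of its reverse keep their initial directions.\<close>

lemma gates_split_old:
  assumes "v \<in> verts H"
  shows "gates H' h' v = gates H h v"
proof -
  have vx: "v \<noteq> x"
    using assms new_vertex by auto
  have hd: "hd p = hd (on_edge h a)" "hd (bar_path r) = hd (on_edge h (bar a))"
  proof -
    show "hd p = hd (on_edge h a)"
      using pos by simp
    have "on_edge h (bar a) = bar_path r @ bar_path p"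
      using on_edge_bar[OF arc] prefix_rest(3) by (metis bar_path_append)
    then show "hd (bar_path r) = hd (on_edge h (bar a))"
      using prefix_rest(2) by simp
  qed
  show ?thesis
  proof
    show "gates H' h' v \<subseteq> gates H h v"
    proof
      fix y assume "y \<in> gates H' h' v"
      then obtain d where d: "d \<in> arcs H'" "tail H' d = v" "y = hd (on_edge h' d)"
        by (auto simp: gates_def)
      from d(1,2) vx consider "d \<in> arcs H" | "d = a1" | "d = bar a2"
        by (auto simp: arcs_split tail_split_new)
      then show "y \<in> gates H h v"
      proof cases
        case 1
        then show ?thesis
          using d by (auto simp: gates_def split_old)
      next
        case 2
        then have "y = hd (on_edge h a)" "tail H a = v"
          using d hd by (auto simp: tail_split_new on_edge_split_new)
        then show ?thesis
          using arc by (auto simp: gates_def)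
      next
        case 3
        then have "y = hd (on_edge h (bar a))" "tail H (bar a) = v"
          using d hd arc by (auto simp: tail_split_new on_edge_split_new head_conv_tail)
        then show ?thesis
          using arc by (auto simp: gates_def)
      qed
    qed
    show "gates H h v \<subseteq> gates H' h' v"
    proof
      fix y assume "y \<in> gates H h v"
      then obtain d where d: "d \<in> arcs H" "tail H d = v" "y = hd (on_edge h d)"
        by (auto simp: gates_def)
      define d' where "d' = (if d = a then a1 else if d = bar a then bar a2 else d)"
      have "d' \<in> arcs H'" "tail H' d' = v" "y = hd (on_edge h' d')"
        using d arc hd
        by (auto simp: d'_def arcs_split tail_split_new on_edge_split_new split_old head_conv_tail)
      then show "y \<in> gates H' h' v"
        by (auto simp: gates_def)
    qed
  qed
qed

lemma gates_split_new: "gates H' h' x = {hd r, bar (last p)}"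
proof -
  have x: "tail H d \<noteq> x" if "d \<in> arcs H" for d
    using tail_in_verts[OF that] new_vertex by auto
  have "out_arcs H' x = {bar a1, a2}"
  proof
    show "out_arcs H' x \<subseteq> {bar a1, a2}"
    proof
      fix d assume "d \<in> out_arcs H' x"
      then have d: "d \<in> arcs H'" "tail H' d = x"
        by auto
      have "d \<notin> arcs H"
        using x[of d] split_old(1)[of d] d(2) by auto
      moreover have "d \<noteq> a1" "d \<noteq> bar a2"
        using x[OF arc] x[OF bar_in_arcs[OF arc]] d(2) arc
        by (auto simp: tail_split_new head_conv_tail)
      ultimately show "d \<in> {bar a1, a2}"
        using d(1) by (auto simp: arcs_split)
    qed
    show "{bar a1, a2} \<subseteq> out_arcs H' x"
      using tail_split_new by (auto simp: arcs_split out_arcs_def)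
  qed
  then show ?thesis
    using prefix_rest by (auto simp: gates_def on_edge_split_new hd_bar_path)
qed

lemma split_word:
  assumes "distinct w" "set w \<subseteq> arcs H"
  shows "distinct (subst_word (split_dart a a1 a2) w)"
    and "set (subst_word (split_dart a a1 a2) w) \<subseteq> arcs H'"
proof -
  show "set (subst_word (split_dart a a1 a2) w) \<subseteq> arcs H'"
    using assms(2) by (auto simp: subst_word_def split_dart_def arcs_split)
  show "distinct (subst_word (split_dart a a1 a2) w)"
    using assms
  proof (induction w)
    case (Cons d w)
    have "set (split_dart a a1 a2 d) \<inter> set (split_dart a a1 a2 d') = {}" if "d' \<in> set w" for d'
      using that Cons.prems old_distinct[of d] old_distinct[of d'] new_distinct
      by (auto simp: split_dart_def)
    moreover have "distinct (split_dart a a1 a2 d)"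
      using new_distinct by (auto simp: split_dart_def)
    ultimately show ?case
      using Cons by (auto simp: subst_word_def)
  qed (simp add: subst_word_def)
qed

end

section \<open>Initial parts of edges\<close>

context edge_immersion
begin

lemma initial_edge_cases:
  assumes "initial_edge G k a a1 s H h H1 h1"
  obtains (whole) "a \<in> arcs H" "k = length (on_edge h a)" "a1 = a" "s = (\<lambda>d. [d])" "H1 = H" "h1 = h"
  | (part) x a2 where "edge_subdivision H h k a a1 a2 x" "s = split_dart a a1 a2"
      "H1 = split_graph x a a1 a2 H" "h1 = split_gmap G k x a a1 a2 h"
proof -
  have a: "a \<in> arcs H"
    using assms by (simp add: initial_edge_def)
  from assms consider
    "k = length (on_edge h a)" "a1 = a" "s = (\<lambda>d. [d])" "H1 = H" "h1 = h"
  | x a2 where "0 < k" "k < length (on_edge h a)" "x \<notin> verts H" "fst a1 \<notin> edges H"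
      "fst a2 \<notin> edges H" "fst a1 \<noteq> fst a2" "s = split_dart a a1 a2"
      "H1 = split_graph x a a1 a2 H" "h1 = split_gmap G k x a a1 a2 h"
    unfolding initial_edge_def by blast
  then show thesis
  proof cases
    case 1
    then show thesis
      using a whole by blast
  next
    case (2 x a2)
    then have "edge_subdivision H h k a a1 a2 x"
      using a by unfold_locales auto
    then show thesis
      using 2 part by blast
  qed
qed

context
  fixes G k a a1 s H1 h1
  assumes initial: "initial_edge G k a a1 s H h H1 h1"
begin

lemma initial_edge_immersion: "edge_immersion H1 h1"
  using initial
proof (cases rule: initial_edge_cases)
  case whole
  then show ?thesis
    using edge_immersion_axioms by simp
next
  case (part x a2)
  then interpret edge_subdivision H h G k a a1 a2 x
    by simp
  show ?thesis
    using part split.edge_immersion_axioms by simp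
qed

lemma initial_edge_result:
  "a \<in> arcs H" "a1 \<in> arcs H1" "on_edge h1 a1 = take k (on_edge h a)" "tail H1 a1 = tail H a"
  "verts H1 = insert (head H1 a1) (verts H)"
proof -
  show "a \<in> arcs H"
    using initial by (simp add: initial_edge_def)
  have "a1 \<in> arcs H1 \<and> on_edge h1 a1 = take k (on_edge h a) \<and> tail H1 a1 = tail H a \<and>
    verts H1 = insert (head H1 a1) (verts H)"
    using initial
  proof (cases rule: initial_edge_cases)
    case whole
    then show ?thesis
      using tail_in_verts[of "bar a"] by (auto simp: head_conv_tail insert_absorb)
  next
    case (part x a2)
    then interpret edge_subdivision H h G k a a1 a2 x
      by simp
    show ?thesis
      using part by (simp add: arcs_split on_edge_split_new tail_split_new head_split_new verts_split)
  qed
  then show "a1 \<in> arcs H1" "on_edge h1 a1 = take k (on_edge h a)" "tail H1 a1 = tail H a"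
    "verts H1 = insert (head H1 a1) (verts H)"
    by auto
qed

lemma initial_edge_invariants: "excess H1 = excess H" "total_length H1 h1 = total_length H h"
proof -
  have "excess H1 = excess H \<and> total_length H1 h1 = total_length H h"
    using initial
  proof (cases rule: initial_edge_cases)
    case (part x a2)
    then interpret edge_subdivision H h G k a a1 a2 x
      by simp
    show ?thesis
      using part by (simp add: excess_split total_length_split)
  qed simp
  then show "excess H1 = excess H" "total_length H1 h1 = total_length H h"
    by auto
qed

lemma initial_edge_other_arcs:
  assumes "d \<in> arcs H" "d \<noteq> a" "d \<noteq> bar a"
  shows "d \<in> arcs H1" "tail H1 d = tail H d" "head H1 d = head H d" "on_edge h1 d = on_edge h d"
    "fst d \<noteq> fst a1"
proof -
  have "d \<in> arcs H1 \<and> tail H1 d = tail H d \<and> head H1 d = head H d \<and> on_edge h1 d = on_edge h d \<and>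
    fst d \<noteq> fst a1"
    using initial
  proof (cases rule: initial_edge_cases)
    case whole
    then show ?thesis
      using assms by (auto simp: fst_eq_iff_bar)
  next
    case (part x a2)
    then interpret edge_subdivision H h G k a a1 a2 x
      by simp
    show ?thesis
      using part assms new_edges edge_name_iff[of d] by (auto simp: arcs_split split_old)
  qed
  then show "d \<in> arcs H1" "tail H1 d = tail H d" "head H1 d = head H d" "on_edge h1 d = on_edge h d"
    "fst d \<noteq> fst a1"
    by auto
qed

lemma initial_edge_bar_survives:
  assumes "bar a \<in> arcs H1"
  shows "k = length (on_edge h a)"
  using initial
proof (cases rule: initial_edge_cases)
  case (part x a2)
  then interpret edge_subdivision H h G k a a1 a2 x
    by simp
  have "bar a \<in> arcs H"
    using arc by simp
  then have False
    using assms part old_distinct[of "bar a"] by (auto simp: arcs_split)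
  then show ?thesis ..
qed simp

lemma initial_edge_gates:
  assumes "v \<in> verts H"
  shows "gates H1 h1 v = gates H h v"
  using initial
proof (cases rule: initial_edge_cases)
  case (part x a2)
  then interpret edge_subdivision H h G k a a1 a2 x
    by simp
  show ?thesis
    using part assms by (simp add: gates_split_old)
qed simp

text \<open>
  From a new vertex, one edge leads on along the rest of the image and one leads back along the
  initial part. Their first edges differ because the image is reduced.
\<close>

lemma initial_edge_new_vertex:
  assumes "head H1 a1 \<notin> verts H"
  shows "k < length (on_edge h a)"
    and "gates H1 h1 (head H1 a1) = {hd (drop k (on_edge h a)), bar (last (take k (on_edge h a)))}"
    and "hd (drop k (on_edge h a)) \<noteq> bar (last (take k (on_edge h a)))"
proof -
  have "k < length (on_edge h a) \<and>
    gates H1 h1 (head H1 a1) = {hd (drop k (on_edge h a)), bar (last (take k (on_edge h a)))} \<and>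
    hd (drop k (on_edge h a)) \<noteq> bar (last (take k (on_edge h a)))"
    using initial
  proof (cases rule: initial_edge_cases)
    case whole
    then show ?thesis
      using assms tail_in_verts[of "bar a"] by (simp add: head_conv_tail)
  next
    case (part x a2)
    then interpret edge_subdivision H h G k a a1 a2 x
      by simp
    show ?thesis
      using part less gates_split_new prefix_rest_reduced by (simp add: head_split_new)
  qed
  then show "k < length (on_edge h a)"
    "gates H1 h1 (head H1 a1) = {hd (drop k (on_edge h a)), bar (last (take k (on_edge h a)))}"
    "hd (drop k (on_edge h a)) \<noteq> bar (last (take k (on_edge h a)))"
    by auto
qed

lemma initial_edge_head:
  assumes "head H1 a1 \<in> verts H"
  shows "head H1 a1 = head H a"
  using initial
proof (cases rule: initial_edge_cases)
  case (part x a2)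
  then interpret edge_subdivision H h G k a a1 a2 x
    by simp
  show ?thesis
    using part assms new_vertex by (simp add: head_split_new)
qed simp

lemma initial_edge_word:
  assumes "distinct w" "set w \<subseteq> arcs H"
  shows "distinct (subst_word s w)" "set (subst_word s w) \<subseteq> arcs H1"
proof -
  have "distinct (subst_word s w) \<and> set (subst_word s w) \<subseteq> arcs H1"
    using initial
  proof (cases rule: initial_edge_cases)
    case whole
    then show ?thesis
      using assms by (simp add: subst_word_def)
  next
    case (part x a2)
    then interpret edge_subdivision H h G k a a1 a2 x
      by simp
    show ?thesis
      using part assms split_word by simp
  qed
  then show "distinct (subst_word s w)" "set (subst_word s w) \<subseteq> arcs H1"
    by auto
qed

end

end

section \<open>The two edges of a fold\<close>

lemma subst_word_subst_word: "subst_word t (subst_word s w) = subst_word (\<lambda>d. subst_word t (s d)) w"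
  by (induction w) (auto simp: subst_word_def)

text \<open>
  The second edge is subdivided in the graph that results from subdividing the first, but the
  length of the common initial path is that of the original images.
\<close>

locale fold_preparation = edge_immersion H h
  for H :: "('v, 'e) graph" and h :: "('v, 'e) gmap" +
  fixes G :: "('v, 'e) graph" and k :: nat and a b a1 b1 :: "'e dart" and s1 s2
    and H1 :: "('v, 'e) graph" and h1 and H2 :: "('v, 'e) graph" and h2
  assumes arc_b: "b \<in> arcs H" and folded_neq: "a \<noteq> b" and same_tail: "tail H a = tail H b"
    and k_def: "k = length (common_initial_path h a b)"
    and first: "initial_edge G k a a1 s1 H h H1 h1"
    and second: "initial_edge G k b b1 s2 H1 h1 H2 h2"
begin

sublocale one: edge_immersion H1 h1
  by (rule initial_edge_immersion[OF first])

sublocale two: edge_immersion H2 h2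
  by (rule one.initial_edge_immersion[OF second])

lemma arc_a: "a \<in> arcs H"
  by (rule initial_edge_result(1)[OF first])

lemma arc_b_one: "b \<in> arcs H1"
  by (rule one.initial_edge_result(1)[OF second])

text \<open>
  If \<open>b\<close> were the reverse of \<open>a\<close>, then, since it is still there after the first
  subdivision, all of \<open>a\<close> would lie in the common initial path, so the image of \<open>a\<close>
  would be its own reverse.
\<close>

lemma folded_neq_bar: "b \<noteq> bar a"
proof
  assume b: "b = bar a"
  have "k = length (on_edge h a)"
    using initial_edge_bar_survives[OF first] arc_b_one b by simp
  moreover have "on_edge h b = bar_path (on_edge h a)"
    using b arc_a by (simp add: on_edge_bar)
  ultimately have "bar_path (on_edge h a) = on_edge h a"
    using longest_common_prefix_eq_take[of "on_edge h a" "on_edge h b"] k_def by simp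
  then show False
    using bar_path_neq_self arc_a on_edge_reduced on_edge_nonempty by blast
qed

abbreviation (input) "p \<equiv> on_edge h a"
abbreviation (input) "p' \<equiv> on_edge h b"

lemma on_edge_b_one: "on_edge h1 b = on_edge h b"
  by (cases "b = bar a"; cases "b = a")
     (use folded_neq folded_neq_bar initial_edge_other_arcs(4)[OF first arc_b] in auto)

lemma a1_one: "a1 \<in> arcs H1" "a1 \<noteq> b" "a1 \<noteq> bar b"
proof -
  show "a1 \<in> arcs H1"
    by (rule initial_edge_result(2)[OF first])
  have "fst b \<noteq> fst a1"
    using initial_edge_other_arcs(5)[OF first arc_b] folded_neq folded_neq_bar by auto
  then show "a1 \<noteq> b" "a1 \<noteq> bar b"
    by auto
qed

lemmas a1_two = one.initial_edge_other_arcs[OF second a1_one]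

lemma b1_two: "b1 \<in> arcs H2"
  by (rule one.initial_edge_result(2)[OF second])

lemma names_differ: "fst a1 \<noteq> fst b1"
  by (rule a1_two(5))

lemma same_image: "on_edge h2 a1 = on_edge h2 b1"
proof -
  have "on_edge h2 a1 = take k p"
    using a1_two(4) initial_edge_result(3)[OF first] by simp
  also have "\<dots> = take k p'"
    using longest_common_prefix_eq_take[of p p'] k_def by simp
  also have "\<dots> = on_edge h2 b1"
    using one.initial_edge_result(3)[OF second] on_edge_b_one by simp
  finally show ?thesis .
qed

lemma same_tail_two: "tail H2 a1 = tail H2 b1"
proof -
  have "tail H1 b = tail H b"
    using initial_edge_other_arcs(2)[OF first arc_b] folded_neq folded_neq_bar by simp
  then show ?thesis
    using a1_two(2) initial_edge_result(4)[OF first] one.initial_edge_result(4)[OF second] same_tail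
    by simp
qed

lemma verts_two: "verts H2 = insert (head H2 b1) (insert (head H2 a1) (verts H))"
  using one.initial_edge_result(5)[OF second] initial_edge_result(5)[OF first] a1_two(3) by simp

lemma invariants_two: "excess H2 = excess H" "total_length H2 h2 = total_length H h"
  using one.initial_edge_invariants[OF second] initial_edge_invariants[OF first] by auto

lemma gates_two_old:
  assumes "v \<in> verts H"
  shows "gates H2 h2 v = gates H h v"
  using one.initial_edge_gates[OF second, of v] initial_edge_gates[OF first, of v]
    initial_edge_result(5)[OF first] assms by simp

lemma gates_two_new_a:
  assumes "head H2 a1 \<notin> verts H"
  shows "k < length p" "gates H2 h2 (head H2 a1) = {hd (drop k p), bar (last (take k p))}"
    "hd (drop k p) \<noteq> bar (last (take k p))"
  using initial_edge_new_vertex[OF first] one.initial_edge_gates[OF second, of "head H1 a1"]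
    initial_edge_result(5)[OF first] a1_two(3) assms by auto

lemma gates_two_new_b:
  assumes "head H2 b1 \<notin> verts H"
  shows "k < length p'" "gates H2 h2 (head H2 b1) = {hd (drop k p'), bar (last (take k p'))}"
    "hd (drop k p') \<noteq> bar (last (take k p'))"
proof -
  have "head H1 b \<in> verts H"
    using initial_edge_other_arcs(3)[OF first arc_b] folded_neq folded_neq_bar arc_b
      tail_in_verts[of "bar b"] by (simp add: head_conv_tail)
  then have "head H2 b1 \<notin> verts H1"
    using one.initial_edge_head[OF second] assms by metis
  from one.initial_edge_new_vertex[OF second this] on_edge_b_one
  show "k < length p'" "gates H2 h2 (head H2 b1) = {hd (drop k p'), bar (last (take k p'))}"
    "hd (drop k p') \<noteq> bar (last (take k p'))"
    by auto
qed

lemma two_le_card_gates_two: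
  assumes "\<And>v. v \<in> verts H \<Longrightarrow> 2 \<le> card (gates H h v)" "v \<in> verts H2"
  shows "2 \<le> card (gates H2 h2 v)"
proof (cases "v \<in> verts H")
  case True
  then show ?thesis
    using assms(1) gates_two_old by simp
next
  case False
  then consider "v = head H2 a1" | "v = head H2 b1"
    using assms(2) verts_two by auto
  then show ?thesis
    by cases (use False gates_two_new_a gates_two_new_b in auto)
qed

text \<open>
  If both edges are subdivided, then the two new vertices together have three gates: back along the
  common initial path, and forward along the two remaining images, which differ in their first
  edge because the common path is maximal.
\<close>

lemma three_le_card_gates_new:
  assumes "head H2 a1 \<notin> verts H" "head H2 b1 \<notin> verts H"
  shows "3 \<le> card (gates H2 h2 (head H2 a1) \<union> gates H2 h2 (head H2 b1))"
proof -
  note ga = gates_two_new_a[OF assms(1)] and gb = gates_two_new_b[OF assms(2)]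
  have same: "take k p = take k p'"
    using longest_common_prefix_eq_take[of p p'] k_def by simp
  have "hd (drop k p) \<noteq> hd (drop k p')"
    using longest_common_prefix_maximal[of p p'] ga(1) gb(1) k_def by simp
  then have "card {hd (drop k p), hd (drop k p'), bar (last (take k p))} = 3"
    using ga(3) gb(3) same by simp
  moreover have "gates H2 h2 (head H2 a1) \<union> gates H2 h2 (head H2 b1)
      = {hd (drop k p), hd (drop k p'), bar (last (take k p))}"
    using ga(2) gb(2) same by auto
  ultimately show ?thesis
    by simp
qed

lemma word_two:
  assumes "distinct w" "set w \<subseteq> arcs H"
  shows "distinct (subst_word (\<lambda>d. subst_word s2 (s1 d)) w)"
    "set (subst_word (\<lambda>d. subst_word s2 (s1 d)) w) \<subseteq> arcs H2"
  using one.initial_edge_word[OF second initial_edge_word[OF first assms]]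
  by (simp_all add: subst_word_subst_word)

end

section \<open>Folding two edges\<close>

locale edge_fold = edge_immersion H h
  for H :: "('v, 'e) graph" and h :: "('v, 'e) gmap" +
  fixes a b :: "'e dart"
  assumes arc_a: "a \<in> arcs H" and arc_b: "b \<in> arcs H" and names_differ: "fst a \<noteq> fst b"
    and same_tail: "tail H a = tail H b" and same_image: "on_edge h a = on_edge h b"
begin

abbreviation (input) "H' \<equiv> folded_graph a b H"

definition merge :: "'v \<Rightarrow> 'v" where
  "merge v = (if v = head H b then head H a else v)"

lemma folded_simps:
  "verts H' = merge ` verts H" "arcs H' = arcs H - {b, bar b}"
  "tail H' d = merge (tail H d)" "head H' d = merge (head H d)"
  by (auto simp: folded_graph_def merge_def Let_def)

sublocale fold: edge_immersion H' h
  by unfold_locales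
    (auto simp: folded_simps finite_verts finite_arcs tail_in_verts head_conv_tail on_edge_bar
      on_edge_nonempty on_edge_reduced bar_eq_swap)

lemma merge_heads: "merge (head H b) = head H a" "merge (head H a) = head H a"
  by (auto simp: merge_def)

text \<open>
  The edge that is removed has the same image, and after the fold the same endpoints, as the one
  that is kept. So the gates that it provided, at both of its ends, are not lost.
\<close>

lemma gates_merge:
  assumes "v \<in> verts H"
  shows "gates H h v \<subseteq> gates H' h (merge v)"
proof
  fix y assume "y \<in> gates H h v"
  then obtain d where d: "d \<in> arcs H" "tail H d = v" "y = hd (on_edge h d)"
    by (auto simp: gates_def)
  \<comment> \<open>If \<open>d\<close> is removed, then the corresponding dart of the kept edge replaces it.\<close>
  define d' where "d' = (if d = b then a else if d = bar b then bar a else d)"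
  have ab: "a \<noteq> b" "a \<noteq> bar b" "bar a \<noteq> b"
    using names_differ by auto
  have "d' \<in> arcs H'"
    using d arc_a ab by (auto simp: d'_def folded_simps)
  moreover have "merge (tail H d') = merge (tail H d)"
    using same_tail merge_heads arc_a arc_b by (simp add: d'_def head_conv_tail)
  moreover have "on_edge h d' = on_edge h d"
    using same_image arc_a arc_b by (simp add: d'_def on_edge_bar)
  ultimately have "d' \<in> out_arcs H' (merge v)" "y = hd (on_edge h d')"
    using d by (auto simp: folded_simps)
  then show "y \<in> gates H' h (merge v)"
    by (auto simp: gates_def)
qed

lemma card_gates_merge:
  assumes "v \<in> verts H"
  shows "card (gates H h v) \<le> card (gates H' h (merge v))"
  using gates_merge[OF assms] by (intro card_mono) auto

lemma folded_arcs: "{b, bar b} \<subseteq> arcs H" "card {b, bar b} = 2"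
  using arc_b by auto

text \<open>
  A fold removes two darts. It also removes a vertex, unless the terminal points already coincide,
  in which case the excess becomes smaller.
\<close>

lemma excess_fold: "excess H' \<le> excess H"
proof -
  have "card (arcs H') = card (arcs H) - 2"
    using folded_arcs by (simp add: folded_simps card_Diff_subset)
  moreover have "2 \<le> card (arcs H)"
    using card_mono[OF finite_arcs folded_arcs(1)] folded_arcs(2) by simp
  moreover have "card (verts H) - 1 \<le> card (verts H')"
  proof -
    have "verts H - {head H b} \<subseteq> verts H'"
      by (force simp: folded_simps merge_def)
    then have "card (verts H - {head H b}) \<le> card (verts H')"
      by (intro card_mono fold.finite_verts)
    then show ?thesis
      using card_Diff1_le[of "verts H" "head H b"] card_Diff_singleton_if[of "verts H" "head H b"]
      by (simp split: if_splits)
  qed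
  ultimately show ?thesis
    by (simp add: excess_def)
qed

lemma total_length_fold: "total_length H' h + 2 \<le> total_length H h"
proof -
  have "total_length H h = total_length H' h + (\<Sum>d\<in>{b, bar b}. length (on_edge h d))"
    unfolding total_length_def folded_simps
    using sum.subset_diff[OF folded_arcs(1) finite_arcs] .
  moreover have "(\<Sum>d\<in>{b, bar b}. length (on_edge h d)) = 2 * length (on_edge h b)"
    using arc_b by (simp add: on_edge_bar)
  moreover have "1 \<le> length (on_edge h b)"
    using on_edge_nonempty[OF arc_b] by (cases "on_edge h b") auto
  ultimately show ?thesis
    by simp
qed

text \<open>
  What the tightening removes is one occurrence of each folded edge, in opposite directions. The
  occurrences that remain again traverse each edge at most once in each direction.
\<close>

lemma fold_word:
  assumes "distinct ([\<alpha>, bar \<beta>] @ w)" "set w \<subseteq> arcs H" "{\<alpha>, \<beta>} = {bar a, bar b}"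
  shows "distinct (map (fold_dart a b) w)" "set (map (fold_dart a b) w) \<subseteq> arcs H'"
proof -
  have ab: "a \<noteq> b" "a \<noteq> bar b" "bar a \<noteq> b"
    using names_differ by auto
  show "set (map (fold_dart a b) w) \<subseteq> arcs H'"
    using assms(2) ab arc_a by (auto simp: fold_dart_def folded_simps)
  from assms(3) ab consider "\<alpha> = bar a" "\<beta> = bar b" | "\<alpha> = bar b" "\<beta> = bar a"
    by (auto simp: doubleton_eq_iff)
  then have "inj_on (fold_dart a b) (set w)"
    by cases (use assms(1) in \<open>auto simp: inj_on_def fold_dart_def\<close>)
  then show "distinct (map (fold_dart a b) w)"
    using assms(1) by (simp add: distinct_map)
qed

end

section \<open>A subdivision followed by a fold\<close>

text \<open>
  What holds for \<open>G\<^bsub>2i\<^esub>\<close>, \<open>g\<^bsub>i\<^esub>\<close> and \<open>\<sigma>\<^bsub>2i\<^esub>\<close>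
  all along: the map is tight, and the word traverses each edge at most once in each direction, so
  that the number of darts bounds its length.
\<close>

definition tight_stage :: "('v, 'e) graph \<Rightarrow> ('v, 'e) gmap \<Rightarrow> 'e dart list \<Rightarrow> bool" where
  "tight_stage H h w \<longleftrightarrow> edge_immersion H h \<and> (\<forall>v\<in>verts H. 2 \<le> card (gates H h v)) \<and>
     distinct w \<and> set w \<subseteq> arcs H"

context fold_preparation
begin

sublocale two: edge_fold H2 h2 a1 b1
  by unfold_locales (fact a1_two(1) b1_two names_differ same_tail_two same_image)+

lemma two_le_card_gates_fold:
  assumes "\<And>v. v \<in> verts H \<Longrightarrow> 2 \<le> card (gates H h v)" "v \<in> verts (folded_graph a1 b1 H2)"
  shows "2 \<le> card (gates (folded_graph a1 b1 H2) h2 v)"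
proof -
  obtain u where u: "u \<in> verts H2" "v = two.merge u"
    using assms(2) by (auto simp: two.folded_simps)
  then show ?thesis
    using two_le_card_gates_two[OF assms(1) u(1)] two.card_gates_merge[OF u(1)] by simp
qed

text \<open>
  This is where the number of vertices is kept under control. Subdividing creates vertices
  with two gates, and there may be arbitrarily many folds. But a vertex created by subdividing
  only one of the two edges is merged with an old vertex, whose gates survive. If both edges are
  subdivided, then the two new vertices are merged into one with three gates. So every vertex with two
  gates after the fold comes from an old vertex with two gates.
\<close>

lemma few_gates_fold: "few_gates (folded_graph a1 b1 H2) h2 \<subseteq> two.merge ` few_gates H h"
proof
  let ?H = "folded_graph a1 b1 H2"
  fix v assume "v \<in> few_gates ?H h2"
  then have v: "v \<in> verts ?H" "card (gates ?H h2 v) \<le> 2"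
    by (auto simp: few_gates_def)
  have heads: "head H2 a1 \<in> verts H2" "head H2 b1 \<in> verts H2"
    using verts_two by auto
  have old: "v \<in> two.merge ` few_gates H h" if "u \<in> verts H" "v = two.merge u" for u
  proof -
    have "card (gates H h u) \<le> 2"
      using two.card_gates_merge[of u] that v(2) gates_two_old[OF that(1)] verts_two by simp
    then show ?thesis
      using that by (auto simp: few_gates_def)
  qed
  obtain u where u: "u \<in> verts H2" "v = two.merge u"
    using v(1) by (auto simp: two.folded_simps)
  show "v \<in> two.merge ` few_gates H h"
  proof (cases "u \<in> verts H")
    case True
    then show ?thesis
      using old u by blast
  next
    case False
    then have veq: "v = head H2 a1"
      using u verts_two two.merge_heads by auto
    consider "head H2 a1 \<in> verts H" | "head H2 b1 \<in> verts H"
      | "head H2 a1 \<notin> verts H" "head H2 b1 \<notin> verts H"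
      by blast
    then show ?thesis
    proof cases
      case 3
      have "gates H2 h2 (head H2 a1) \<union> gates H2 h2 (head H2 b1) \<subseteq> gates ?H h2 v"
        using two.gates_merge[OF heads(1)] two.gates_merge[OF heads(2)] two.merge_heads veq
        by simp
      then have "card (gates H2 h2 (head H2 a1) \<union> gates H2 h2 (head H2 b1)) \<le> card (gates ?H h2 v)"
        by (intro card_mono) auto
      then show ?thesis
        using three_le_card_gates_new[OF 3] v(2) by simp
    qed (use old veq two.merge_heads in \<open>metis\<close>)+
  qed
qed

end

lemma fold_round:
  assumes stage: "tight_stage H h w"
    and sub: "subdivide_step G a b a1 b1 s H h w H1 h1 w1"
    and fold: "fold_step a1 b1 H1 h1 w1 H2 h2 w2"
    and annulus: "fold_annulus l a1 b1 w1 w2 A"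
  shows "tight_stage H2 h2 w2" "length w1 = length w2 + 2" "w1 = subst_word s w"
    "card (few_gates H2 h2) \<le> card (few_gates H h)" "excess H2 \<le> excess H"
    "total_length H2 h2 + 2 \<le> total_length H h"
proof -
  interpret edge_immersion H h
    using stage by (simp add: tight_stage_def)
  define k where "k = length (common_initial_path h a b)"
  from sub obtain H' h' s1 s2 where
    "initial_edge G k a a1 s1 H h H' h'" "initial_edge G k b b1 s2 H' h' H1 h1"
    and s: "s = (\<lambda>d. subst_word s2 (s1 d))"
    unfolding subdivide_step_def Let_def k_def by blast
  then interpret fold_preparation H h G k a b a1 b1 s1 s2 H' h' H1 h1
    using sub by unfold_locales (auto simp: subdivide_step_def k_def)
  have w1: "w1 = subst_word s w"
    using sub by (simp add: subdivide_step_def)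
  then have w1_ok: "distinct w1" "set w1 \<subseteq> arcs H1"
    using word_two[of w] stage s by (auto simp: tight_stage_def)
  have H2: "H2 = folded_graph a1 b1 H1" "h2 = h1"
    using fold by (auto simp: fold_step_def)
  from annulus obtain \<alpha> \<beta> r r' v u c z where
    \<alpha>\<beta>: "{\<alpha>, \<beta>} = {bar a1, bar b1}"
    and v: "v = rotate r w1" "v = [\<alpha>, bar \<beta>] @ u @ [c] @ z"
    and w2: "rotate r' w2 = map (fold_dart a1 b1) (u @ [c] @ z)"
    unfolding fold_annulus_def Let_def by blast
  have v_ok: "distinct v" "set v \<subseteq> arcs H1" "length v = length w1"
    using w1_ok v(1) by auto
  then have rest: "distinct ([\<alpha>, bar \<beta>] @ (u @ [c] @ z))" "set (u @ [c] @ z) \<subseteq> arcs H1"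
    using v(2) by auto
  note folded = two.fold_word[OF rest \<alpha>\<beta>]
  have "distinct w2" "set w2 \<subseteq> arcs H2"
    using folded unfolding w2[symmetric] H2 by auto
  then show "tight_stage H2 h2 w2"
    using two.fold.edge_immersion_axioms two_le_card_gates_fold stage H2
    by (simp add: tight_stage_def)
  show "length w1 = length w2 + 2"
    using v_ok(3) v(2) arg_cong[OF w2, of length] by simp
  show "w1 = subst_word s w"
    by (rule w1)
  have "finite (few_gates H h)"
    using finite_verts by (simp add: few_gates_def)
  then show "card (few_gates H2 h2) \<le> card (few_gates H h)"
    unfolding H2 using few_gates_fold surj_card_le by blast
  show "excess H2 \<le> excess H"
    using two.excess_fold invariants_two H2 by simp
  show "total_length H2 h2 + 2 \<le> total_length H h"
    using two.total_length_fold invariants_two H2 by simp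
qed

section \<open>Counting the triangles of an annulus\<close>

definition annulus_triangles :: "pairing \<Rightarrow> vertex set set" where
  "annulus_triangles A = (\<Union>(t, t')\<in>A. {set t, set t'})"

lemma card_triangulation:
  assumes "triangulates xs T"
  shows "finite T \<and> card T + 2 \<le> length xs"
  using assms by induction (auto simp: card_insert_if)

lemma card_annulus_triangles_le:
  assumes "finite A"
  shows "finite (annulus_triangles A)" "card (annulus_triangles A) \<le> 2 * card A"
proof -
  have "card (annulus_triangles A) \<le> (\<Sum>x\<in>A. card (case x of (t, t') \<Rightarrow> {set t, set t'}))"
    unfolding annulus_triangles_def by (rule card_UN_le) fact
  also have "\<dots> \<le> (\<Sum>x\<in>A. 2)"
    by (intro sum_mono) (auto simp: card_insert_if split: prod.splits)
  finally show "card (annulus_triangles A) \<le> 2 * card A"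
    by (simp add: mult.commute)
  show "finite (annulus_triangles A)"
    unfolding annulus_triangles_def using assms by auto
qed

text \<open>
  Each triangle of a pair is attributed to the letter whose polygon contains it. The polygon of a
  letter then accounts for exactly the triangles of its own triangulation, so the bound is
  a sum over letters. Which of the two forms a polygon takes depends only on the
  direction of the letter.
\<close>

lemma card_triangulated_polygons:
  fixes N :: "nat \<Rightarrow> nat"
  assumes "finite J"
    and tri: "\<And>j. j \<in> J \<Longrightarrow> triangulates [0..<N j + 3] (E (fst (w ! j)))"
    and A: "A \<subseteq> (\<Union>{paired_polygons (E (fst (w ! j))) (ps j) (ps' j') | j j'.
              j \<in> J \<and> j' \<in> J \<and> snd (w ! j) \<and> w ! j' = bar (w ! j)})"
  shows "finite (annulus_triangles A)" "card (annulus_triangles A) \<le> (\<Sum>j\<in>J. N j + 1)"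
proof -
  define T where
    "T j = (\<lambda>is. set (map ((!) (if snd (w ! j) then ps j else ps' j)) is)) ` E (fst (w ! j))" for j
  have T: "finite (T j)" "card (T j) \<le> N j + 1" if "j \<in> J" for j
  proof -
    have E: "finite (E (fst (w ! j)))" "card (E (fst (w ! j))) \<le> N j + 1"
      using card_triangulation[OF tri[OF that]] by auto
    then show "finite (T j)"
      by (simp add: T_def)
    show "card (T j) \<le> N j + 1"
      unfolding T_def using card_image_le[OF E(1)] E(2) by (rule order_trans)
  qed
  have sub: "annulus_triangles A \<subseteq> (\<Union>j\<in>J. T j)"
  proof
    fix y assume "y \<in> annulus_triangles A"
    then obtain t t' where tt: "(t, t') \<in> A" "y = set t \<or> y = set t'"
      by (auto simp: annulus_triangles_def)
    then obtain j j' where j: "j \<in> J" "j' \<in> J" "snd (w ! j)" "w ! j' = bar (w ! j)"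
      "(t, t') \<in> paired_polygons (E (fst (w ! j))) (ps j) (ps' j')"
      using A by blast
    then obtain "is" where "is": "is \<in> E (fst (w ! j))" "t = map ((!) (ps j)) is"
      "t' = map ((!) (ps' j')) is"
      by (auto simp: paired_polygons_def)
    have "set t \<in> T j"
      using j "is" by (auto simp: T_def)
    moreover have "set t' \<in> T j'"
      using j "is" by (auto simp: T_def)
    ultimately show "y \<in> (\<Union>j\<in>J. T j)"
      using tt j by auto
  qed
  have fin: "finite (\<Union>j\<in>J. T j)"
    using T assms(1) by blast
  with sub show "finite (annulus_triangles A)"
    using finite_subset by blast
  have "card (annulus_triangles A) \<le> card (\<Union>j\<in>J. T j)"
    by (rule card_mono[OF fin sub])
  also have "\<dots> \<le> (\<Sum>j\<in>J. card (T j))"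
    by (rule card_UN_le) fact
  also have "\<dots> \<le> (\<Sum>j\<in>J. N j + 1)"
    by (intro sum_mono T)
  finally show "card (annulus_triangles A) \<le> (\<Sum>j\<in>J. N j + 1)" .
qed

lemma card_subdivision_annulus:
  assumes "subdivision_annulus l s w A"
  shows "finite (annulus_triangles A)"
    and "card (annulus_triangles A) \<le> length w + length (subst_word s w)"
proof -
  define P where "P = on_level l w 0"
  define Q where "Q = on_level (l + 1) (subst_word s w) 0"
  define top where "top j = length (subst_word s (take j w))" for j
  obtain E where tri: "\<And>j. j < length w \<Longrightarrow> triangulates [0..<length (s (w ! j)) + 3] (E (fst (w ! j)))"
    and A: "A = (\<Union>{paired_polygons (E (fst (w ! j)))
        (polygon P Q j (top j) (length (s (w ! j)))) (opposite_polygon P Q j' (top j') (length (s (w ! j')))) | j j'.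
        j < length w \<and> j' < length w \<and> snd (w ! j) \<and> w ! j' = bar (w ! j)})"
    using assms unfolding subdivision_annulus_def Let_def P_def[symmetric] Q_def[symmetric]
      top_def[symmetric] by (elim exE conjE) (rule that, simp_all)
  note count = card_triangulated_polygons[of "{..<length w}" "\<lambda>j. length (s (w ! j))" E w A
      "\<lambda>j. polygon P Q j (top j) (length (s (w ! j)))"
      "\<lambda>j. opposite_polygon P Q j (top j) (length (s (w ! j)))"]
  show "finite (annulus_triangles A)"
    by (rule count(1)) (use tri A in simp_all)
  have "card (annulus_triangles A) \<le> (\<Sum>j<length w. length (s (w ! j)) + 1)"
    by (rule count(2)) (use tri A in simp_all)
  also have "\<dots> = length w + length (subst_word s w)"
    by (simp add: subst_word_def length_concat sum_list_sum_nth sum_Suc atLeast0LessThan)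
  finally show "card (annulus_triangles A) \<le> length w + length (subst_word s w)" .
qed

lemma annulus_triangles_Un: "annulus_triangles (A \<union> B) = annulus_triangles A \<union> annulus_triangles B"
  by (auto simp: annulus_triangles_def)

lemma card_three_elements_le: "card {x, y, z} \<le> 3"
  using card_length[of "[x, y, z]"] by simp

lemma card_fold_triangles:
  "finite (fold_triangles_1 P Q m k q) \<and> card (fold_triangles_1 P Q m k q) \<le> 3"
  "finite (fold_triangles_2 P Q m k q) \<and> card (fold_triangles_2 P Q m k q) \<le> 3"
  unfolding fold_triangles_1_def fold_triangles_2_def Let_def
  by (intro conjI card_three_elements_le finite.intros)+

text \<open>
  Two triangles for each letter of \<open>w\<close> would make twice its length. The four letters
  that belong to the folded edges, at the positions \<open>0\<close>, \<open>1\<close>, \<open>m\<close> and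
  \<open>q\<close>, contribute three pairs of triangles instead of four, and \<open>w'\<close> is shorter
  than \<open>w\<close> by two.
\<close>

lemma card_fold_annulus:
  assumes "fold_annulus l a1 b1 w w' A"
  shows "finite (annulus_triangles A)"
    and "card (annulus_triangles A) \<le> length w + length w'"
proof -
  obtain \<alpha> \<beta> r r' v u c z q E where
    v: "v = rotate r w" "v = [\<alpha>, bar \<beta>] @ u @ [c] @ z"
    and w': "rotate r' w' = map (fold_dart a1 b1) (u @ [c] @ z)"
    and q: "length u + 2 < q" "q < length v"
    and E: "\<And>e. triangulates [0..<4] (E e)"
    and cs: "c = bar \<alpha> \<and> v ! q = \<beta> \<and>
        A = fold_rectangles (on_level l w r) (on_level (l + 1) w' r') v {fst \<alpha>, fst \<beta>} E \<union>
          fold_triangles_1 (on_level l w r) (on_level (l + 1) w' r') (length u + 2) (length u) q \<or>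
      c = \<beta> \<and> v ! q = bar \<alpha> \<and>
        A = fold_rectangles (on_level l w r) (on_level (l + 1) w' r') v {fst \<alpha>, fst \<beta>} E \<union>
          fold_triangles_2 (on_level l w r) (on_level (l + 1) w' r') (length u + 2) (length u) q"
    using assms unfolding fold_annulus_def Let_def 
    by (elim exE conjE) (rule that, assumption+, erule spec, assumption)
  define P where "P = on_level l w r"
  define Q where "Q = on_level (l + 1) w' r'"
  define X where "X = {fst \<alpha>, fst \<beta>}"
  obtain B where B: "A = fold_rectangles P Q v X E \<union> B" "finite B" "card B \<le> 3"
    using cs card_fold_triangles[of P Q "length u + 2" "length u" q]
    unfolding P_def[symmetric] Q_def[symmetric] X_def[symmetric] by (elim disjE conjE) (rule that, auto)
  have len: "length v = length w" "length v = length w' + 2"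
    using arg_cong[OF v(1), of length] arg_cong[OF v(2), of length] arg_cong[OF w', of length] by simp_all
  define J where "J = {j. j < length v \<and> fst (v ! j) \<notin> X}"
  have "v ! (length u + 2) = c"
    using v(2) by (simp add: nth_append)
  then have X: "fst (v ! 0) \<in> X" "fst (v ! 1) \<in> X" "fst (v ! (length u + 2)) \<in> X" "fst (v ! q) \<in> X"
    using v(2) cs by (auto simp: X_def)
  have "J \<subseteq> {..<length v} - {0, 1, length u + 2, q}"
    using X by (auto simp: J_def)
  then have "card J \<le> card ({..<length v} - {0, 1, length u + 2, q})"
    by (intro card_mono) auto
  also have "\<dots> = length v - 4"
    using q by (subst card_Diff_subset) auto
  finally have J: "card J \<le> length v - 4" .
  have finJ: "finite J"
    by (simp add: J_def)
  have tri: "triangulates [0..<(\<lambda>_. 1) j + 3] (E (fst (v ! j)))" for j :: nat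
    using E by simp
  have rect: "fold_rectangles P Q v X E \<subseteq> (\<Union>{paired_polygons (E (fst (v ! j)))
      (polygon P Q j (j - 2) 1) (opposite_polygon P Q j' (j' - 2) 1) | j j'.
       j \<in> J \<and> j' \<in> J \<and> snd (v ! j) \<and> v ! j' = bar (v ! j)})"
  proof
    fix y assume "y \<in> fold_rectangles P Q v X E"
    then obtain j j' where "j < length v" "j' < length v" "fst (v ! j) \<notin> X" "snd (v ! j)"
      "v ! j' = bar (v ! j)"
      "y \<in> paired_polygons (E (fst (v ! j))) (polygon P Q j (j - 2) 1) (opposite_polygon P Q j' (j' - 2) 1)"
      unfolding fold_rectangles_def by blast
    moreover from this have "j \<in> J" "j' \<in> J"
      by (auto simp: J_def)
    ultimately show "y \<in> (\<Union>{paired_polygons (E (fst (v ! j)))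
      (polygon P Q j (j - 2) 1) (opposite_polygon P Q j' (j' - 2) 1) | j j'.
       j \<in> J \<and> j' \<in> J \<and> snd (v ! j) \<and> v ! j' = bar (v ! j)})"
      by blast
  qed
  note rectangles = card_triangulated_polygons[of J "\<lambda>_. 1" E v, OF finJ tri rect]
  show "finite (annulus_triangles A)"
    using rectangles(1) card_annulus_triangles_le(1)[OF B(2)] B(1) by (simp add: annulus_triangles_Un)
  have "card (annulus_triangles A)
      \<le> card (annulus_triangles (fold_rectangles P Q v X E)) + card (annulus_triangles B)"
    unfolding B(1) annulus_triangles_Un by (rule card_Un_le)
  also have "\<dots> \<le> 2 * card J + 2 * card B"
    using rectangles(2) card_annulus_triangles_le(2)[OF B(2)] by simp
  also have "\<dots> \<le> 2 * (length v - 4) + 6"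
    using J B(3) by simp
  also have "\<dots> = length w + length w'"
    using len q by simp
  finally show "card (annulus_triangles A) \<le> length w + length w'" .
qed

section \<open>The sequence of folds\<close>

lemma tight_stage_initial:
  assumes "finite_graph G" "graph_map G G f" "tight G f" "distinct \<sigma>" "set \<sigma> \<subseteq> arcs G"
  shows "tight_stage G f \<sigma>"
proof -
  have fin: "fin_digraph G"
    and bidirected: "bidirected_digraph G (\<lambda>a. if a \<in> arcs G then bar a else a)"
    using assms(1) by (auto simp: finite_graph_def)
  interpret fin_digraph G
    by (rule fin)
  interpret bidirected: bidirected_digraph G "\<lambda>a. if a \<in> arcs G then bar a else a"
    by (rule bidirected)
  have bar: "bar a \<in> arcs G" "tail G (bar a) = head G a" if "a \<in> arcs G" for a
    using bidirected.arev_in_arcs[OF that] bidirected.tail_arev[OF that] that by simp_all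
  have imm: "edge_immersion G f"
    using bar assms(2,3)
    by unfold_locales (auto simp: graph_map_def tight_def immersed_on_edges_def)
  have "2 \<le> card (gates G f v)" if v: "v \<in> verts G" for v
  proof -
    obtain a b where ab: "a \<in> out_arcs G v" "b \<in> out_arcs G v" "common_initial_path f a b = []"
      using assms(3) v unfolding tight_def by blast
    then have "hd (on_edge f a) \<noteq> hd (on_edge f b)"
      using edge_immersion.on_edge_nonempty[OF imm]
      by (simp add: longest_common_prefix_eq_Nil_iff)
    then have "card {hd (on_edge f a), hd (on_edge f b)} = 2"
      by simp
    moreover have "{hd (on_edge f a), hd (on_edge f b)} \<subseteq> gates G f v"
      using ab by (auto simp: gates_def)
    ultimately show ?thesis
      using card_mono[OF edge_immersion.finite_gates[OF imm]] by metis
  qed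
  then show ?thesis
    using imm assms by (simp add: tight_stage_def)
qed

lemma tight_stage_length_le:
  assumes "tight_stage H h w"
  shows "int (length w) \<le> 2 * int (card (few_gates H h)) + 3 * excess H"
proof -
  interpret edge_immersion H h
    using assms by (simp add: tight_stage_def)
  have "length w = card (set w)"
    using assms by (simp add: tight_stage_def distinct_card)
  also have "\<dots> \<le> card (arcs H)"
    using assms finite_arcs by (intro card_mono) (auto simp: tight_stage_def)
  finally show ?thesis
    using card_arcs_le assms by (force simp: tight_stage_def)
qed

lemma card_UN_pairs_le:
  fixes T :: "nat \<Rightarrow> 'a set"
  assumes "\<And>i. i < n \<Longrightarrow> card (T (2 * i)) + card (T (2 * i + 1)) \<le> B"
  shows "card (\<Union>l<2 * n. T l) \<le> n * B"
  using assms
proof (induction n)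
  case (Suc n)
  have "(\<Union>l<2 * Suc n. T l) = (\<Union>l<2 * n. T l) \<union> (T (2 * n) \<union> T (2 * n + 1))"
    by (auto simp: lessThan_Suc)
  then have "card (\<Union>l<2 * Suc n. T l) \<le> card (\<Union>l<2 * n. T l) + (card (T (2 * n)) + card (T (2 * n + 1)))"
    using card_Un_le[of "\<Union>l<2 * n. T l" "T (2 * n) \<union> T (2 * n + 1)"]
      card_Un_le[of "T (2 * n)" "T (2 * n + 1)"] by simp
  also have "\<dots> \<le> n * B + B"
    using Suc by (intro add_mono) auto
  finally show ?case
    by simp
qed simp

text \<open>
  The two annuli of a round have at most as many triangles as the letters of
  \<open>\<sigma>\<^bsub>2i\<^esub>\<close>, twice \<open>\<sigma>\<^bsub>2i+1\<^esub>\<close> and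
  \<open>\<sigma>\<^bsub>2i+2\<^esub>\<close> together. The words of even index have at most \<open>D\<close>
  letters, and \<open>\<sigma>\<^bsub>2i+1\<^esub>\<close> is longer than \<open>\<sigma>\<^bsub>2i+2\<^esub>\<close>
  by two. This gives \<open>4 D + 4\<close> triangles.
\<close>

lemma fold_sequence:
  fixes Gs :: "nat \<Rightarrow> ('v, 'e) graph"
  assumes stage: "tight_stage (Gs 0) (gs 0) (ws 0)"
    and rounds: "\<And>i. i < n \<Longrightarrow> \<exists>a b a1 b1 s.
      subdivide_step G a b a1 b1 s (Gs (2 * i)) (gs (2 * i)) (ws (2 * i))
        (Gs (2 * i + 1)) (gs (2 * i + 1)) (ws (2 * i + 1)) \<and>
      fold_step a1 b1 (Gs (2 * i + 1)) (gs (2 * i + 1)) (ws (2 * i + 1))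
        (Gs (2 * i + 2)) (gs (2 * i + 2)) (ws (2 * i + 2)) \<and>
      subdivision_annulus (2 * i) s (ws (2 * i)) (As (2 * i)) \<and>
      fold_annulus (2 * i + 1) a1 b1 (ws (2 * i + 1)) (ws (2 * i + 2)) (As (2 * i + 1))"
    and bound: "2 * int (card (few_gates (Gs 0) (gs 0))) + 3 * excess (Gs 0) \<le> int D"
  shows "2 * n \<le> total_length (Gs 0) (gs 0)"
    and "finite (\<Union>l<2 * n. annulus_triangles (As l))"
    and "card (\<Union>l<2 * n. annulus_triangles (As l)) \<le> n * (4 * D + 4)"
proof -
  have inv: "tight_stage (Gs (2 * i)) (gs (2 * i)) (ws (2 * i)) \<and>
    card (few_gates (Gs (2 * i)) (gs (2 * i))) \<le> card (few_gates (Gs 0) (gs 0)) \<and>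
    excess (Gs (2 * i)) \<le> excess (Gs 0) \<and>
    total_length (Gs (2 * i)) (gs (2 * i)) + 2 * i \<le> total_length (Gs 0) (gs 0)" if "i \<le> n" for i
    using that
  proof (induction i)
    case 0
    then show ?case
      using stage by simp
  next
    case (Suc i)
    then have "i < n"
      by simp
    obtain a b a1 b1 s where
      "subdivide_step G a b a1 b1 s (Gs (2 * i)) (gs (2 * i)) (ws (2 * i))
        (Gs (2 * i + 1)) (gs (2 * i + 1)) (ws (2 * i + 1))"
      "fold_step a1 b1 (Gs (2 * i + 1)) (gs (2 * i + 1)) (ws (2 * i + 1))
        (Gs (2 * i + 2)) (gs (2 * i + 2)) (ws (2 * i + 2))"
      "fold_annulus (2 * i + 1) a1 b1 (ws (2 * i + 1)) (ws (2 * i + 2)) (As (2 * i + 1))"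
      using rounds[OF \<open>i < n\<close>] by blast
    from fold_round[OF _ this] Suc show ?case
      by (simp add: add.commute)
  qed
  show "2 * n \<le> total_length (Gs 0) (gs 0)"
    using inv[of n] by simp
  have length_le: "length (ws (2 * i)) \<le> D" if "i \<le> n" for i
  proof -
    have "int (length (ws (2 * i))) \<le> int D"
      using tight_stage_length_le inv[OF that] bound by (smt (verit) of_nat_mono)
    then show ?thesis
      by simp
  qed
  have round: "finite (annulus_triangles (As (2 * i))) \<and> finite (annulus_triangles (As (2 * i + 1))) \<and>
    card (annulus_triangles (As (2 * i))) + card (annulus_triangles (As (2 * i + 1))) \<le> 4 * D + 4"
    if i: "i < n" for i
  proof -
    obtain a b a1 b1 s where
      sub: "subdivide_step G a b a1 b1 s (Gs (2 * i)) (gs (2 * i)) (ws (2 * i))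
        (Gs (2 * i + 1)) (gs (2 * i + 1)) (ws (2 * i + 1))"
      and fold: "fold_step a1 b1 (Gs (2 * i + 1)) (gs (2 * i + 1)) (ws (2 * i + 1))
        (Gs (2 * i + 2)) (gs (2 * i + 2)) (ws (2 * i + 2))"
      and annuli: "subdivision_annulus (2 * i) s (ws (2 * i)) (As (2 * i))"
        "fold_annulus (2 * i + 1) a1 b1 (ws (2 * i + 1)) (ws (2 * i + 2)) (As (2 * i + 1))"
      using rounds[OF i] by blast
    have "tight_stage (Gs (2 * i)) (gs (2 * i)) (ws (2 * i))"
      using inv[of i] that by simp
    note r = fold_round[OF this sub fold annuli(2)]
    have "length (ws (2 * i)) \<le> D" "length (ws (2 * i + 2)) \<le> D"
      using length_le[of i] length_le[of "Suc i"] that by auto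
    then show ?thesis
      using card_subdivision_annulus[OF annuli(1)] card_fold_annulus[OF annuli(2)] r(2,3) by simp
  qed
  show "card (\<Union>l<2 * n. annulus_triangles (As l)) \<le> n * (4 * D + 4)"
    by (rule card_UN_pairs_le) (use round in blast)
  have "finite (annulus_triangles (As l))" if "l < 2 * n" for l
  proof (cases "even l")
    case True
    then show ?thesis
      using round[of "l div 2"] that by auto
  next
    case False
    then obtain i where "l = 2 * i + 1"
      by (auto elim: oddE)
    then show ?thesis
      using round[of i] that by auto
  qed
  then show "finite (\<Union>l<2 * n. annulus_triangles (As l))"
    by blast
qed

theorem proposition2p4:
  fixes G :: "('v, 'e) graph" and f :: "('v, 'e) gmap" and \<sigma> :: "'e dart list"
    and S :: "'s::topological_space set" and q :: "complex \<Rightarrow> 's" and \<phi> :: "'s \<Rightarrow> 's"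
    and g :: nat and \<T> :: ideal_triangulation
  assumes "finite_graph G"
    and "\<forall>v\<in>verts G. out_degree G v \<ge> 3"
    and "surface_with_spine S q G \<sigma>"
    and "once_punctured_genus G g"
    and "dehn_twist_product S \<phi>"
    and "graph_map G G f"
    and "tight G f"
    and "homotopy_equivalence_representing S q \<sigma> f \<phi>"
    and "triangulation_produced G f \<sigma> \<T>"
  shows "finite (tetrahedra \<T>) \<and>
    int (card (tetrahedra \<T>)) \<le> 16 * (5 * int g - 2) * int (map_size G f)"
proof -
  have \<sigma>: "distinct \<sigma>" "set \<sigma> \<subseteq> arcs G"
    using assms(3) by (auto simp: surface_with_spine_def)
  have stage: "tight_stage G f \<sigma>"
    by (rule tight_stage_initial[OF assms(1,6,7) \<sigma>])
  then interpret edge_immersion G f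
    by (simp add: tight_stage_def)
  have excess: "excess G = 4 * int g - 2"
    using assms(4) card_arcs by (simp add: excess_def once_punctured_genus_def)
  have "(\<Sum>v\<in>verts G. 3) \<le> (\<Sum>v\<in>verts G. card (out_arcs G v))"
    using assms(2) by (intro sum_mono) (auto simp: out_degree_def)
  then have "3 * card (verts G) \<le> card (arcs G)"
    by (simp add: sum_card_out_arcs mult.commute)
  then have verts: "int (card (verts G)) \<le> 4 * int g - 2"
    using excess by (simp add: excess_def)
  have "card (few_gates G f) \<le> card (verts G)"
    using finite_verts by (intro card_mono) (auto simp: few_gates_def)
  with verts have few: "int (card (few_gates G f)) \<le> 4 * int g - 2"
    by simp
  \<comment> \<open>The bound \<open>2 N + 3 X\<close> on the number of darts, where both the number \<open>N\<close> of
    vertices with two gates and the excess \<open>X\<close> are at most \<open>4 g - 2\<close>.\<close>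
  define D where "D = 20 * g - 10"
  have "1 \<le> g"
    using verts by linarith
  then have D: "int D = 20 * int g - 10"
    by (simp add: D_def)

  obtain K where K: "torus_produced G f \<sigma> K" and \<T>: "\<T> = cone_triangulation K"
    using assms(9) by (auto simp: triangulation_produced_def)
  obtain n Gs gs ws As where start: "Gs 0 = G" "gs 0 = f" "ws 0 = \<sigma>"
    and rounds: "\<And>i. i < n \<Longrightarrow> \<exists>a b a1 b1 s.
      subdivide_step G a b a1 b1 s (Gs (2 * i)) (gs (2 * i)) (ws (2 * i))
        (Gs (2 * i + 1)) (gs (2 * i + 1)) (ws (2 * i + 1)) \<and>
      fold_step a1 b1 (Gs (2 * i + 1)) (gs (2 * i + 1)) (ws (2 * i + 1))
        (Gs (2 * i + 2)) (gs (2 * i + 2)) (ws (2 * i + 2)) \<and>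
      subdivision_annulus (2 * i) s (ws (2 * i)) (As (2 * i)) \<and>
      fold_annulus (2 * i + 1) a1 b1 (ws (2 * i + 1)) (ws (2 * i + 2)) (As (2 * i + 1))"
    and triangles: "triangles K = (\<Union>l<2 * n. annulus_triangles (As l))"
    using K unfolding torus_produced_def
    by (elim exE conjE)
      (rule that, assumption+, drule spec, drule mp, assumption, elim conjE, assumption,
        simp add: annulus_triangles_def)
  have bound: "2 * int (card (few_gates (Gs 0) (gs 0))) + 3 * excess (Gs 0) \<le> int D"
    using few excess D start by simp
  have "tight_stage (Gs 0) (gs 0) (ws 0)"
    using stage start by simp
  note sequence = fold_sequence[OF this rounds bound]
  have fin: "finite (triangles K)"
    using sequence(2) triangles by simp
  have tetrahedra: "tetrahedra \<T> = (\<lambda>t. insert None (Some ` t)) ` triangles K"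
    by (simp add: \<T> cone_triangulation_def)
  have "card (tetrahedra \<T>) \<le> card (triangles K)"
    unfolding tetrahedra by (rule card_image_le[OF fin])
  also have "\<dots> \<le> n * (4 * D + 4)"
    using sequence(3) triangles by simp
  also have "\<dots> \<le> map_size G f * (4 * D + 4)"
    using sequence(1) start total_length_eq by (intro mult_right_mono) auto
  finally have "int (card (tetrahedra \<T>)) \<le> int (map_size G f * (4 * D + 4))"
    by (simp only: of_nat_le_iff)
  also have "\<dots> = int (map_size G f) * (80 * int g - 36)"
    using D by simp
  also have "\<dots> \<le> int (map_size G f) * (16 * (5 * int g - 2))"
    by (intro mult_left_mono) auto
  finally show ?thesis
    using fin tetrahedra by (simp add: mult.commute)
qed

end
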